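(* For a Lie antialgebra $\mathfrak{a}$, the algebra $\mathrm{Gr}\,\mathcal{U}(\mathfrak{a})$ is not necessarily isomorphic to the algebra $G(\mathfrak{a})$.
   Context: $\mathbb{K}=\mathbb{R}$ or $\mathbb{C}$. A superalgebra is a (not necessarily associative) $\mathbb{Z}_2$-graded algebra $\mathfrak{a}=\mathfrak{a}_0\oplus\mathfrak{a}_1$ over $\mathbb K$; it is supercommutative if $a\cdot b=(-1)^{\bar a\bar b}b\cdot a$ for homogeneous $a,b$ of parities $\bar a,\bar b$. A Lie antialgebra is a supercommutative superalgebra $\mathfrak{a}=\mathfrak{a}_0\oplus\mathfrak{a}_1$ such that, for all $x,x_i\in\mathfrak{a}_0$ and $y,y_i\in\mathfrak{a}_1$: (LA0) $x_1(x_2x_3)=(x_1x_2)x_3$; (LA1) $x_1(x_2y)=\frac12(x_1x_2)y$; (LA2) $x(y_1y_2)=(xy_1)y_2+y_1(xy_2)$; (LA3) $y_1(y_2y_3)+y_2(y_3y_1)+y_3(y_1y_2)=0$. The universal enveloping algebra is $\mathcal{U}(\mathfrak{a}):=\mathcal{T}(\mathfrak{a})/\langle\mathcal{P}\rangle$, where $\mathcal{T}(\mathfrak{a})=\bigoplus_{n\ge0}\mathfrak a^{\otimes n}$ is the tensor algebra and $\langle\mathcal{P}\rangle$ is the two-sided ideal generated by the elements $\frac12(a\otimes b-b\otimes a)-ab$, $\ \frac12(a\otimes x+x\otimes a)-ax$, $\ x\otimes y-xy$, for $a,b\in\mathfrak{a}_1$, $x,y\in\mathfrak{a}_0$. It is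 filtered by $\mathcal{U}_n$ = image of $\bigoplus_{0\le k\le n}\mathfrak{a}^{\otimes k}$, with $\mathcal U_0=\mathbb K$ and $\mathcal U_{-1}=\{0\}$, and $\mathrm{Gr}\,\mathcal{U}(\mathfrak a):=\bigoplus_{n\ge0}\mathcal{U}_n/\mathcal{U}_{n-1}$ is the associated graded algebra. $G(\mathfrak{a}):=\mathcal{T}(\mathfrak{a})/\langle\mathcal{R}\rangle$, where $\langle\mathcal R\rangle$ is the two-sided ideal generated by $\mathcal{R}=\{a\otimes b-b\otimes a,\ a\otimes x+x\otimes a,\ x\otimes y : x,y\in\mathfrak{a}_0,\ a,b\in\mathfrak{a}_1\}$. (The enveloping algebra is said to satisfy the Poincaré–Birkhoff–Witt property if $\mathrm{Gr}\,\mathcal{U}(\mathfrak a)\cong G(\mathfrak a)$.) *)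

theory Defs
  imports
    Complex_Main
    "HOL-Library.Z2"
    "HOL-Library.Function_Algebras"
    "HOL-Algebra.QuotRing"
    "HOL-Algebra.Module"
begin

section \<open>Lie antialgebras\<close>

text \<open>The homogeneous components \<open>A 0\<close>, \<open>A 1\<close> are subspaces of an ambient vector space, which need
  not be exhausted by their sum; the algebra itself is \<open>A 0 \<oplus> A 1\<close>. Nothing is assumed about the
  product \<open>m\<close> outside of it.\<close>

definition supercarrier :: "(bit \<Rightarrow> 'v::ab_group_add set) \<Rightarrow> 'v set" where
  "supercarrier A = {x + y | x y. x \<in> A 0 \<and> y \<in> A 1}"

locale superalgebra = vector_space scale
  for scale :: "'k::field \<Rightarrow> 'v::ab_group_add \<Rightarrow> 'v" +
  fixes A :: "bit \<Rightarrow> 'v set" and m :: "'v \<Rightarrow> 'v \<Rightarrow> 'v"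
  assumes subspace_component: "subspace (A i)"
    and components_Int: "A 0 \<inter> A 1 = {0}"
    and m_graded: "\<lbrakk>u \<in> A i; v \<in> A j\<rbrakk> \<Longrightarrow> m u v \<in> A (i + j)"
    and m_add_left: "\<lbrakk>u \<in> supercarrier A; v \<in> supercarrier A; w \<in> supercarrier A\<rbrakk>
          \<Longrightarrow> m (u + v) w = m u w + m v w"
    and m_add_right: "\<lbrakk>u \<in> supercarrier A; v \<in> supercarrier A; w \<in> supercarrier A\<rbrakk>
          \<Longrightarrow> m u (v + w) = m u v + m u w"
    and m_scale_left: "\<lbrakk>u \<in> supercarrier A; v \<in> supercarrier A\<rbrakk>
          \<Longrightarrow> m (scale c u) v = scale c (m u v)"
    and m_scale_right: "\<lbrakk>u \<in> supercarrier A; v \<in> supercarrier A\<rbrakk>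
          \<Longrightarrow> m u (scale c v) = scale c (m u v)"

locale lie_antialgebra = superalgebra +
  assumes supercommutative:
      "\<lbrakk>u \<in> A i; v \<in> A j\<rbrakk> \<Longrightarrow> m u v = (if i * j = 1 then - m v u else m v u)"
    and LA0: "\<lbrakk>x1 \<in> A 0; x2 \<in> A 0; x3 \<in> A 0\<rbrakk> \<Longrightarrow> m x1 (m x2 x3) = m (m x1 x2) x3"
    and LA1: "\<lbrakk>x1 \<in> A 0; x2 \<in> A 0; y \<in> A 1\<rbrakk> \<Longrightarrow> m x1 (m x2 y) = scale (1/2) (m (m x1 x2) y)"
    and LA2: "\<lbrakk>x \<in> A 0; y1 \<in> A 1; y2 \<in> A 1\<rbrakk> \<Longrightarrow> m x (m y1 y2) = m (m x y1) y2 + m y1 (m x y2)"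
    and LA3: "\<lbrakk>y1 \<in> A 1; y2 \<in> A 1; y3 \<in> A 1\<rbrakk>
          \<Longrightarrow> m y1 (m y2 y3) + m y2 (m y3 y1) + m y3 (m y1 y2) = 0"


section \<open>Associative unital algebras over a field\<close>

text \<open>Such an algebra is represented by a record of type \<open>module\<close> from HOL-Algebra, with scalars
  taken from a type of class \<open>field\<close>. Two-sided ring ideals of a unital algebra are closed under
  scalars, so \<open>genideal\<close> is also the generated algebra ideal.\<close>

definition quotient_algebra :: "('k, 'b) module \<Rightarrow> 'b set \<Rightarrow> ('k, 'b set) module" where
  "quotient_algebra R I =
     \<lparr>carrier = carrier (R Quot I), monoid.mult = monoid.mult (R Quot I), one = one (R Quot I),
      zero = zero (R Quot I), add = add (R Quot I),
      smult = (\<lambda>c X. \<Union>x\<in>X. I +>\<^bsub>R\<^esub> (c \<odot>\<^bsub>R\<^esub> x))\<rparr>"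

lemma ring_quotient_algebra:
  assumes "ideal I R" shows "ring (quotient_algebra R I)"
proof -
  interpret Q: ring "R Quot I"
    by (rule ideal.quotient_is_ring[OF assms])
  show ?thesis
  proof (rule ringI)
    show "abelian_group (quotient_algebra R I)"
      by (rule abelian_groupI) (auto simp: quotient_algebra_def Q.a_ac intro: Q.l_neg)
    show "monoid (quotient_algebra R I)"
      by (rule monoidI) (auto simp: quotient_algebra_def Q.m_assoc)
  qed (auto simp: quotient_algebra_def Q.l_distr Q.r_distr)
qed

definition algebra_isomorphic :: "('k, 'b) module \<Rightarrow> ('k, 'c) module \<Rightarrow> bool" where
  "algebra_isomorphic R S \<longleftrightarrow>
     (\<exists>h \<in> ring_iso R S. \<forall>c. \<forall>x \<in> carrier R. h (c \<odot>\<^bsub>R\<^esub> x) = c \<odot>\<^bsub>S\<^esub> h x)"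

text \<open>For a filtration \<open>F\<close> (with \<open>F (-1) = {0}\<close>) of \<open>R\<close>, the elements of \<open>\<Oplus>\<^sub>n F n / F (n - 1)\<close> are
  the families of cosets of which all but finitely many are zero. The \<open>n\<close>-th component of a product
  is the coset of \<open>\<Sum>\<^sub>i u\<^sub>i v\<^sub>n\<^sub>-\<^sub>i\<close>, taken (as in \<open>rcoset_mult\<close>) over all choices of representatives.\<close>

definition associated_graded :: "('k, 'b) module \<Rightarrow> (int \<Rightarrow> 'b set) \<Rightarrow> ('k, nat \<Rightarrow> 'b set) module"
  where
  "associated_graded R F =
     \<lparr>carrier = {f. (\<forall>n. \<exists>x \<in> F (int n). f n = F (int n - 1) +>\<^bsub>R\<^esub> x)
                  \<and> finite {n. f n \<noteq> F (int n - 1)}},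
      monoid.mult = (\<lambda>f g n. \<Union>u \<in> Pi {..n} f. \<Union>v \<in> Pi {..n} g.
          F (int n - 1) +>\<^bsub>R\<^esub> (\<Oplus>\<^bsub>R\<^esub>i\<in>{..n}. u i \<otimes>\<^bsub>R\<^esub> v (n - i))),
      one = (\<lambda>n. if n = 0 then F (- 1) +>\<^bsub>R\<^esub> \<one>\<^bsub>R\<^esub> else F (int n - 1)),
      zero = (\<lambda>n. F (int n - 1)),
      add = (\<lambda>f g n. f n <+>\<^bsub>R\<^esub> g n),
      smult = (\<lambda>c f n. \<Union>x \<in> f n. F (int n - 1) +>\<^bsub>R\<^esub> (c \<odot>\<^bsub>R\<^esub> x))\<rparr>"


section \<open>The tensor algebra\<close>

text \<open>Free algebra on the set \<open>V\<close>: finitely supported functions on the words in \<open>V\<close>, with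
  the convolution product extending concatenation.\<close>

definition free_algebra :: "'v set \<Rightarrow> ('k::field, 'v list \<Rightarrow> 'k) module" where
  "free_algebra V =
     \<lparr>carrier = {f. finite {w. f w \<noteq> 0} \<and> {w. f w \<noteq> 0} \<subseteq> lists V},
      monoid.mult = (\<lambda>f g w. \<Sum>i\<le>length w. f (take i w) * g (drop i w)),
      one = (\<lambda>w. if w = [] then 1 else 0),
      zero = (\<lambda>w. 0),
      add = (\<lambda>f g w. f w + g w),
      smult = (\<lambda>c f w. c * f w)\<rparr>"

lemma free_algebra_mult_closed:
  assumes f: "f \<in> carrier (free_algebra V)" and g: "g \<in> carrier (free_algebra V)"
  shows "f \<otimes>\<^bsub>free_algebra V\<^esub> g \<in> carrier (free_algebra V)"
proof -
  let ?h = "f \<otimes>\<^bsub>free_algebra V\<^esub> g"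
  let ?S = "(\<lambda>(u, v). u @ v) ` ({w. f w \<noteq> 0} \<times> {w. g w \<noteq> 0})"
  have sub: "{w. ?h w \<noteq> 0} \<subseteq> ?S"
  proof
    fix w assume "w \<in> {w. ?h w \<noteq> 0}"
    then have "(\<Sum>i\<le>length w. f (take i w) * g (drop i w)) \<noteq> 0"
      by (simp add: free_algebra_def)
    then obtain i where "f (take i w) * g (drop i w) \<noteq> 0"
      by (meson sum.neutral)
    then show "w \<in> ?S"
      by (intro image_eqI[of _ _ "(take i w, drop i w)"]) auto
  qed
  have "finite ?S" "?S \<subseteq> lists V" using f g by (fastforce simp: free_algebra_def)+
  with sub show ?thesis
    by (auto simp: free_algebra_def intro: finite_subset)
qed

lemma free_algebra_mult_assoc:
  "(f \<otimes>\<^bsub>free_algebra V\<^esub> g) \<otimes>\<^bsub>free_algebra V\<^esub> h = f \<otimes>\<^bsub>free_algebra V\<^esub> (g \<otimes>\<^bsub>free_algebra V\<^esub> h)"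
proof
  fix w :: "'a list"
  let ?t = "\<lambda>j k. f (take j w) * g (take k (drop j w)) * h (drop (j + k) w)"
  have "((f \<otimes>\<^bsub>free_algebra V\<^esub> g) \<otimes>\<^bsub>free_algebra V\<^esub> h) w = (\<Sum>i\<le>length w. \<Sum>j\<le>i. ?t j (i - j))"
    by (auto simp: free_algebra_def sum_distrib_right min_def drop_take intro!: sum.cong)
  also have "\<dots> = (\<Sum>(j, k)\<in>{(j, k). j + k \<le> length w}. ?t j k)"
    by (rule sum.triangle_reindex_eq[symmetric])
  also have "\<dots> = (\<Sum>(j, k)\<in>(SIGMA j:{..length w}. {..length w - j}). ?t j k)"
    by (rule sum.cong) auto
  also have "\<dots> = (\<Sum>j\<le>length w. \<Sum>k\<le>length w - j. ?t j k)"
    by (rule sum.Sigma[symmetric]) auto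
  also have "\<dots> = (f \<otimes>\<^bsub>free_algebra V\<^esub> (g \<otimes>\<^bsub>free_algebra V\<^esub> h)) w"
    by (auto simp: free_algebra_def sum_distrib_left mult.assoc add.commute intro!: sum.cong)
  finally show "((f \<otimes>\<^bsub>free_algebra V\<^esub> g) \<otimes>\<^bsub>free_algebra V\<^esub> h) w
    = (f \<otimes>\<^bsub>free_algebra V\<^esub> (g \<otimes>\<^bsub>free_algebra V\<^esub> h)) w" .
qed

lemma free_algebra_one:
  "\<one>\<^bsub>free_algebra V\<^esub> \<otimes>\<^bsub>free_algebra V\<^esub> f = f" "f \<otimes>\<^bsub>free_algebra V\<^esub> \<one>\<^bsub>free_algebra V\<^esub> = f"
proof -
  have "(\<Sum>i\<le>length w. (if take i w = [] then 1 else 0) * f (drop i w)) =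
      (\<Sum>i\<le>length w. if i = 0 then f w else 0)" for w
    by (rule sum.cong) auto
  moreover have "(\<Sum>i\<le>length w. f (take i w) * (if drop i w = [] then 1 else 0)) =
      (\<Sum>i\<le>length w. if i = length w then f w else 0)" for w
    by (rule sum.cong) auto
  ultimately show "\<one>\<^bsub>free_algebra V\<^esub> \<otimes>\<^bsub>free_algebra V\<^esub> f = f" "f \<otimes>\<^bsub>free_algebra V\<^esub> \<one>\<^bsub>free_algebra V\<^esub> = f"
    by (simp_all add: free_algebra_def cong: if_cong)
qed

lemma ring_free_algebra: "ring (free_algebra V)"
proof (rule ringI)
  show "abelian_group (free_algebra V :: ('b, 'a list \<Rightarrow> 'b) module)"
  proof (rule abelian_groupI)
    fix x y :: "'a list \<Rightarrow> 'b" assume xy: "x \<in> carrier (free_algebra V)" "y \<in> carrier (free_algebra V)"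
    have "{w. x w + y w \<noteq> 0} \<subseteq> {w. x w \<noteq> 0} \<union> {w. y w \<noteq> 0}" by auto
    then show "x \<oplus>\<^bsub>free_algebra V\<^esub> y \<in> carrier (free_algebra V)"
      using xy by (auto simp: free_algebra_def intro: finite_subset)
  next
    fix x :: "'a list \<Rightarrow> 'b" assume "x \<in> carrier (free_algebra V)"
    then show "\<exists>y\<in>carrier (free_algebra V). y \<oplus>\<^bsub>free_algebra V\<^esub> x = \<zero>\<^bsub>free_algebra V\<^esub>"
      by (intro bexI[of _ "\<lambda>w. - x w"]) (auto simp: free_algebra_def)
  qed (auto simp: free_algebra_def add_ac)
  show "monoid (free_algebra V :: ('b, 'a list \<Rightarrow> 'b) module)"
    by (rule monoidI) (auto simp: free_algebra_mult_closed free_algebra_mult_assoc free_algebra_one,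
      auto simp: free_algebra_def)
qed (auto simp: free_algebra_def algebra_simps sum.distrib)
definition letter :: "'v \<Rightarrow> 'v list \<Rightarrow> 'k::field" where
  "letter v = (\<lambda>w. if w = [v] then 1 else 0)"

text \<open>The ideal generated by the following linearity relations between letters is spanned by the
  multilinearity relations between words of equal length. Hence the quotient is
  \<open>\<Oplus>\<^sub>n V\<^bsup>\<otimes>n\<^esup>\<close>, each \<open>V\<^bsup>\<otimes>n\<^esup>\<close> being the free vector space on \<open>V\<^sup>n\<close> modulo multilinearity, and
  the class of the word \<open>[v\<^sub>1,\<dots>,v\<^sub>n]\<close> is \<open>v\<^sub>1 \<otimes> \<dots> \<otimes> v\<^sub>n\<close>.\<close>

definition linearity_ideal ::
  "('k::field \<Rightarrow> 'v::ab_group_add \<Rightarrow> 'v) \<Rightarrow> 'v set \<Rightarrow> ('v list \<Rightarrow> 'k) set" where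
  "linearity_ideal scale V = genideal (free_algebra V)
     ({\<lambda>w. letter (x + y) w - letter x w - letter y w | x y. x \<in> V \<and> y \<in> V} \<union>
      {\<lambda>w. letter (scale c x) w - c * letter x w | c x. x \<in> V})"

definition tensor_algebra ::
  "('k::field \<Rightarrow> 'v::ab_group_add \<Rightarrow> 'v) \<Rightarrow> 'v set \<Rightarrow> ('k, ('v list \<Rightarrow> 'k) set) module" where
  "tensor_algebra scale V = quotient_algebra (free_algebra V) (linearity_ideal scale V)"

definition tensor_emb ::
  "('k::field \<Rightarrow> 'v::ab_group_add \<Rightarrow> 'v) \<Rightarrow> 'v set \<Rightarrow> 'v \<Rightarrow> ('v list \<Rightarrow> 'k) set" where
  "tensor_emb scale V v = linearity_ideal scale V +>\<^bsub>free_algebra V\<^esub> letter v"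

text \<open>\<open>\<Oplus>\<^sub>0\<^sub>\<le>\<^sub>k\<^sub>\<le>\<^sub>n V\<^bsup>\<otimes>k\<^esup>\<close>, which is \<open>{0}\<close> for negative \<open>n\<close>\<close>

definition tensor_filtration ::
  "('k::field \<Rightarrow> 'v::ab_group_add \<Rightarrow> 'v) \<Rightarrow> 'v set \<Rightarrow> int \<Rightarrow> ('v list \<Rightarrow> 'k) set set" where
  "tensor_filtration scale V n =
     (\<lambda>f. linearity_ideal scale V +>\<^bsub>free_algebra V\<^esub> f) `
       {f \<in> carrier (free_algebra V). \<forall>w. f w \<noteq> 0 \<longrightarrow> int (length w) \<le> n}"


section \<open>The enveloping algebra and the algebra \<open>G\<close>\<close>

definition enveloping_relations ::
  "('k::field \<Rightarrow> 'v::ab_group_add \<Rightarrow> 'v) \<Rightarrow> (bit \<Rightarrow> 'v set) \<Rightarrow> ('v \<Rightarrow> 'v \<Rightarrow> 'v) \<Rightarrow>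
     ('v list \<Rightarrow> 'k) set set" where
  "enveloping_relations scale A m =
     (let T = tensor_algebra scale (supercarrier A); \<iota> = tensor_emb scale (supercarrier A) in
      {((1/2) \<odot>\<^bsub>T\<^esub> (\<iota> a \<otimes>\<^bsub>T\<^esub> \<iota> b \<ominus>\<^bsub>T\<^esub> \<iota> b \<otimes>\<^bsub>T\<^esub> \<iota> a)) \<ominus>\<^bsub>T\<^esub> \<iota> (m a b) | a b. a \<in> A 1 \<and> b \<in> A 1} \<union>
      {((1/2) \<odot>\<^bsub>T\<^esub> (\<iota> a \<otimes>\<^bsub>T\<^esub> \<iota> x \<oplus>\<^bsub>T\<^esub> \<iota> x \<otimes>\<^bsub>T\<^esub> \<iota> a)) \<ominus>\<^bsub>T\<^esub> \<iota> (m a x) | a x. a \<in> A 1 \<and> x \<in> A 0} \<union>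
      {(\<iota> x \<otimes>\<^bsub>T\<^esub> \<iota> y) \<ominus>\<^bsub>T\<^esub> \<iota> (m x y) | x y. x \<in> A 0 \<and> y \<in> A 0})"

definition enveloping_ideal ::
  "('k::field \<Rightarrow> 'v::ab_group_add \<Rightarrow> 'v) \<Rightarrow> (bit \<Rightarrow> 'v set) \<Rightarrow> ('v \<Rightarrow> 'v \<Rightarrow> 'v) \<Rightarrow>
     ('v list \<Rightarrow> 'k) set set" where
  "enveloping_ideal scale A m =
     genideal (tensor_algebra scale (supercarrier A)) (enveloping_relations scale A m)"

definition enveloping_algebra ::
  "('k::field \<Rightarrow> 'v::ab_group_add \<Rightarrow> 'v) \<Rightarrow> (bit \<Rightarrow> 'v set) \<Rightarrow> ('v \<Rightarrow> 'v \<Rightarrow> 'v) \<Rightarrow>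
     ('k, ('v list \<Rightarrow> 'k) set set) module" where
  "enveloping_algebra scale A m =
     quotient_algebra (tensor_algebra scale (supercarrier A)) (enveloping_ideal scale A m)"

definition enveloping_filtration ::
  "('k::field \<Rightarrow> 'v::ab_group_add \<Rightarrow> 'v) \<Rightarrow> (bit \<Rightarrow> 'v set) \<Rightarrow> ('v \<Rightarrow> 'v \<Rightarrow> 'v) \<Rightarrow>
     int \<Rightarrow> ('v list \<Rightarrow> 'k) set set set" where
  "enveloping_filtration scale A m n =
     (\<lambda>t. enveloping_ideal scale A m +>\<^bsub>tensor_algebra scale (supercarrier A)\<^esub> t) `
       tensor_filtration scale (supercarrier A) n"

definition Gr_enveloping ::
  "('k::field \<Rightarrow> 'v::ab_group_add \<Rightarrow> 'v) \<Rightarrow> (bit \<Rightarrow> 'v set) \<Rightarrow> ('v \<Rightarrow> 'v \<Rightarrow> 'v) \<Rightarrow>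
     ('k, nat \<Rightarrow> ('v list \<Rightarrow> 'k) set set set) module" where
  "Gr_enveloping scale A m =
     associated_graded (enveloping_algebra scale A m) (enveloping_filtration scale A m)"

definition G_relations ::
  "('k::field \<Rightarrow> 'v::ab_group_add \<Rightarrow> 'v) \<Rightarrow> (bit \<Rightarrow> 'v set) \<Rightarrow> ('v list \<Rightarrow> 'k) set set" where
  "G_relations scale A =
     (let T = tensor_algebra scale (supercarrier A); \<iota> = tensor_emb scale (supercarrier A) in
      {\<iota> a \<otimes>\<^bsub>T\<^esub> \<iota> b \<ominus>\<^bsub>T\<^esub> \<iota> b \<otimes>\<^bsub>T\<^esub> \<iota> a | a b. a \<in> A 1 \<and> b \<in> A 1} \<union>
      {\<iota> a \<otimes>\<^bsub>T\<^esub> \<iota> x \<oplus>\<^bsub>T\<^esub> \<iota> x \<otimes>\<^bsub>T\<^esub> \<iota> a | a x. a \<in> A 1 \<and> x \<in> A 0} \<union>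
      {\<iota> x \<otimes>\<^bsub>T\<^esub> \<iota> y | x y. x \<in> A 0 \<and> y \<in> A 0})"

definition G_algebra ::
  "('k::field \<Rightarrow> 'v::ab_group_add \<Rightarrow> 'v) \<Rightarrow> (bit \<Rightarrow> 'v set) \<Rightarrow>
     ('k, ('v list \<Rightarrow> 'k) set set) module" where
  "G_algebra scale A =
     (let T = tensor_algebra scale (supercarrier A)
      in quotient_algebra T (genideal T (G_relations scale A)))"

end

theory Submission
  imports Defs "HOL-Algebra.Multiplicative_Group"
begin

text \<open>Let \<open>\<aa>\<close> be spanned by an even idempotent \<open>e\<close> and an odd \<open>a\<close> with \<open>e a = a a = 0\<close>. In the
  enveloping algebra \<open>e\<close> and \<open>a\<close> anticommute and \<open>e\<^sup>2 = e\<close>, so moving \<open>a\<close> past both factors of \<open>e\<^sup>2\<close>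
  shows that they also commute. Hence the enveloping algebra and its associated graded algebra are
  commutative. In \<open>G(\<aa>)\<close>, on the other hand, \<open>a\<close> and \<open>e\<close> do not commute: they act as the
  anticommuting matrices \<open>diag(1, -1)\<close> and \<open>E\<^sub>1\<^sub>2\<close>, and \<open>E\<^sub>1\<^sub>2\<close> squares to zero.\<close>

section \<open>Quotient algebras\<close>

text \<open>Isomorphisms in the sense of \<open>algebra_isomorphic\<close> may ignore the grading,
  so comparing dimensions degree by degree would not suffice. Commutativity is a property that every
  ring isomorphism transports. The example comes from the overlap e e a. By LA1 an even idempotent e
  acts on an odd eigenvector a with an eigenvalue t such that t^2 = t/2, so t is 0 or 1/2. In the
  enveloping algebra e a + a e = 2 t a, and multiplying by e from the left with e^2 = e gives (1 - 2
  t)(e a - a e) = 0. For t = 1/2 this says nothing; t = 0 forces a relation between products of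
  degree two that is absent from \<open>G\<close>. As 2 is invertible, e a even becomes 0 there.
  Relations alone never show that an element of a quotient is nonzero. This is the reason for the
  matrix representation: it is defined on the free algebra and then has to descend through both
  quotients that make up \<open>G\<close>.\<close>

lemma carrier_quotient_algebra:
  "carrier (quotient_algebra R I) = (\<lambda>x. I +>\<^bsub>R\<^esub> x) ` carrier R"
  by (auto simp: quotient_algebra_def FactRing_simps)

lemma quotient_algebra_hom:
  assumes "ideal I R"
  shows "ring_hom_ring R (quotient_algebra R I) (\<lambda>x. I +>\<^bsub>R\<^esub> x)"
proof -
  interpret I: ideal I R by fact
  show ?thesis
  proof (rule ring_hom_ringI2)
    show "(+>\<^bsub>R\<^esub>) I \<in> ring_hom R (quotient_algebra R I)"
      using I.rcos_ring_hom by (simp add: ring_hom_def quotient_algebra_def)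
  qed (use I.ring_axioms ring_quotient_algebra[OF assms] in auto)
qed

lemma quotient_algebra_eqI:
  assumes "ideal I R" "x \<in> carrier R" "y \<in> carrier R" "x \<ominus>\<^bsub>R\<^esub> y \<in> I"
  shows "I +>\<^bsub>R\<^esub> x = I +>\<^bsub>R\<^esub> y"
  using ring.quotient_eq_iff_same_a_r_cos[OF ideal.axioms(2)[OF assms(1)] assms(1-3)] assms(4)
  by simp

text \<open>Universal property of the quotient. It is applied twice in a row, since \<open>G\<close>
  is a quotient of the tensor algebra, itself a quotient of the free algebra.\<close>

lemma quotient_algebra_lift:
  assumes "ideal I R" "ring_hom_ring R S h" "I \<subseteq> a_kernel R S h"
  obtains h' where "ring_hom_ring (quotient_algebra R I) S h'"
    "\<And>x. x \<in> carrier R \<Longrightarrow> h' (I +>\<^bsub>R\<^esub> x) = h x"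
proof -
  interpret I: ideal I R by fact
  interpret h: ring_hom_ring R S h by fact
  let ?Q = "quotient_algebra R I"
  interpret q: ring_hom_ring R ?Q "\<lambda>x. I +>\<^bsub>R\<^esub> x"
    by (rule quotient_algebra_hom) fact
  \<comment> \<open>\<open>h\<close> is constant on each coset, so the image of a coset is a
    singleton and no representative has to be chosen.\<close>
  define h' where "h' X = the_elem (h ` X)" for X
  have h': "h' (I +>\<^bsub>R\<^esub> x) = h x" if x: "x \<in> carrier R" for x
  proof -
    have "h z = h x" if z: "z \<in> I +>\<^bsub>R\<^esub> x" for z
    proof -
      obtain i where i: "i \<in> I" "z = i \<oplus>\<^bsub>R\<^esub> x"
        using z unfolding a_r_coset_def' by blast
      have "h i = \<zero>\<^bsub>S\<^esub>"
        using i(1) assms(3) unfolding a_kernel_def' by blast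
      then show ?thesis
        unfolding i(2) h.hom_add[OF I.a_Hcarr[OF i(1)] x]
        using h.S.l_zero[OF h.hom_closed[OF x]] by argo
    qed
    moreover have "x \<in> I +>\<^bsub>R\<^esub> x" using x by (rule I.a_rcos_self)
    ultimately have "h ` (I +>\<^bsub>R\<^esub> x) = {h x}" by blast
    then show ?thesis by (simp add: h'_def)
  qed
  have "ring_hom_ring ?Q S h'"
  proof (rule ring_hom_ringI)
    show "ring ?Q" "ring S" by (rule q.S.ring_axioms h.S.ring_axioms)+
  next
    fix X assume "X \<in> carrier ?Q"
    then obtain x where x: "x \<in> carrier R" "X = I +>\<^bsub>R\<^esub> x"
      unfolding carrier_quotient_algebra by blast
    show "h' X \<in> carrier S" unfolding x(2) h'[OF x(1)] using x(1) by (rule h.hom_closed)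
  next
    fix X Y assume "X \<in> carrier ?Q" "Y \<in> carrier ?Q"
    then obtain x y where x: "x \<in> carrier R" "X = I +>\<^bsub>R\<^esub> x"
      and y: "y \<in> carrier R" "Y = I +>\<^bsub>R\<^esub> y"
      unfolding carrier_quotient_algebra by blast
    show "h' (X \<otimes>\<^bsub>?Q\<^esub> Y) = h' X \<otimes>\<^bsub>S\<^esub> h' Y"
      unfolding x(2) y(2) q.hom_mult[OF x(1) y(1), symmetric] h'[OF x(1)] h'[OF y(1)]
        h'[OF I.m_closed[OF x(1) y(1)]]
      using x(1) y(1) by (rule h.hom_mult)
    show "h' (X \<oplus>\<^bsub>?Q\<^esub> Y) = h' X \<oplus>\<^bsub>S\<^esub> h' Y"
      unfolding x(2) y(2) q.hom_add[OF x(1) y(1), symmetric] h'[OF x(1)] h'[OF y(1)]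
        h'[OF I.a_closed[OF x(1) y(1)]]
      using x(1) y(1) by (rule h.hom_add)
  next
    show "h' \<one>\<^bsub>?Q\<^esub> = \<one>\<^bsub>S\<^esub>" 
      unfolding q.hom_one[symmetric] h'[OF I.one_closed] by (rule h.hom_one)
  qed
  with h' show ?thesis using that by blast
qed

section \<open>Commutativity under isomorphism and passage to the graded algebra\<close>

lemma algebra_isomorphic_commutative:
  assumes "algebra_isomorphic R S"
    and comm: "\<And>x y. \<lbrakk>x \<in> carrier R; y \<in> carrier R\<rbrakk> \<Longrightarrow> x \<otimes>\<^bsub>R\<^esub> y = y \<otimes>\<^bsub>R\<^esub> x"
    and "x \<in> carrier S" "y \<in> carrier S"
  shows "x \<otimes>\<^bsub>S\<^esub> y = y \<otimes>\<^bsub>S\<^esub> x"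
proof -
  obtain h where h: "h \<in> ring_hom R S" "h ` carrier R = carrier S"
    using assms(1) by (auto simp: algebra_isomorphic_def ring_iso_def bij_betw_def)
  with assms(3,4) obtain a b where "a \<in> carrier R" "x = h a" "b \<in> carrier R" "y = h b"
    by blast
  then show ?thesis using comm ring_hom_mult[OF h(1)] by metis
qed

text \<open>The product of two families is a union over all representatives, and the equality
  already holds for each choice of representatives: reversing the index of the convolution sum
  exchanges the two factors.\<close>

lemma associated_graded_commutative:
  assumes "ring R" and sub: "\<And>n. F n \<subseteq> carrier R"
    and comm: "\<And>x y. \<lbrakk>x \<in> carrier R; y \<in> carrier R\<rbrakk> \<Longrightarrow> x \<otimes>\<^bsub>R\<^esub> y = y \<otimes>\<^bsub>R\<^esub> x"
    and f: "f \<in> carrier (associated_graded R F)" and g: "g \<in> carrier (associated_graded R F)"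
  shows "f \<otimes>\<^bsub>associated_graded R F\<^esub> g = g \<otimes>\<^bsub>associated_graded R F\<^esub> f"
proof -
  interpret R: ring R by fact
  have sub': "k n \<subseteq> carrier R" if k: "k \<in> carrier (associated_graded R F)" for k n
  proof -
    obtain x where "x \<in> F (int n)" "k n = F (int n - 1) +>\<^bsub>R\<^esub> x"
      using k by (auto simp: associated_graded_def)
    then show ?thesis using sub R.a_r_coset_subset_G[of "F (int n - 1)" x] by blast
  qed
  have sum: "(\<Oplus>\<^bsub>R\<^esub>i\<in>{..n}. u i \<otimes>\<^bsub>R\<^esub> v (n - i)) = (\<Oplus>\<^bsub>R\<^esub>i\<in>{..n}. v i \<otimes>\<^bsub>R\<^esub> u (n - i))"
    if u: "u \<in> Pi {..n} f" and v: "v \<in> Pi {..n} g" for u v and n :: nat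
  proof -
    have carr: "u i \<in> carrier R" "v i \<in> carrier R" if "i \<le> n" for i
      using u v that sub'[OF f] sub'[OF g] by blast+
    have im: "(\<lambda>i. n - i) ` {..n} = {..n}"
    proof (intro equalityI subsetI)
      fix j assume "j \<in> {..n}"
      then show "j \<in> (\<lambda>i. n - i) ` {..n}" by (intro image_eqI[of _ _ "n - j"]) auto
    qed auto
    have "(\<Oplus>\<^bsub>R\<^esub>i\<in>{..n}. v i \<otimes>\<^bsub>R\<^esub> u (n - i)) = (\<Oplus>\<^bsub>R\<^esub>i\<in>(\<lambda>i. n - i) ` {..n}. v i \<otimes>\<^bsub>R\<^esub> u (n - i))"
      by (simp only: im)
    also have "\<dots> = (\<Oplus>\<^bsub>R\<^esub>i\<in>{..n}. v (n - i) \<otimes>\<^bsub>R\<^esub> u (n - (n - i)))"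
      by (rule R.finsum_reindex) (auto intro!: carr inj_onI)
    also have "\<dots> = (\<Oplus>\<^bsub>R\<^esub>i\<in>{..n}. u i \<otimes>\<^bsub>R\<^esub> v (n - i))"
      by (rule R.finsum_cong') (auto intro!: carr comm)
    finally show ?thesis by simp
  qed
  show ?thesis
  proof
    fix n
    let ?c = "\<lambda>u v. F (int n - 1) +>\<^bsub>R\<^esub> (\<Oplus>\<^bsub>R\<^esub>i\<in>{..n}. u i \<otimes>\<^bsub>R\<^esub> v (n - i))"
    have "(\<Union>u\<in>Pi {..n} f. \<Union>v\<in>Pi {..n} g. ?c u v) = (\<Union>u\<in>Pi {..n} f. \<Union>v\<in>Pi {..n} g. ?c v u)"
      by (intro SUP_cong refl arg_cong[where f = "\<lambda>x. F (int n - 1) +>\<^bsub>R\<^esub> x"] sum)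
    also have "\<dots> = (\<Union>v\<in>Pi {..n} g. \<Union>u\<in>Pi {..n} f. ?c v u)"
      by (rule SUP_commute)
    finally show "(f \<otimes>\<^bsub>associated_graded R F\<^esub> g) n = (g \<otimes>\<^bsub>associated_graded R F\<^esub> f) n"
      by (simp add: associated_graded_def)
  qed
qed

section \<open>Free algebras\<close>

lemma free_algebra_simps:
  "(f \<oplus>\<^bsub>free_algebra V\<^esub> g) = (\<lambda>w. f w + g w)"
  "\<zero>\<^bsub>free_algebra V\<^esub> = (\<lambda>w. 0)"
  "(c \<odot>\<^bsub>free_algebra V\<^esub> f) = (\<lambda>w. c * f w)"
  by (simp_all add: free_algebra_def)

lemma free_algebra_minus:
  assumes "f \<in> carrier (free_algebra V)" "g \<in> carrier (free_algebra V)"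
  shows "f \<ominus>\<^bsub>free_algebra V\<^esub> g = (\<lambda>w. f w - g w)"
proof -
  interpret F: ring "free_algebra V :: ('b, 'a list \<Rightarrow> 'b) module" by (rule ring_free_algebra)
  have "(f \<ominus>\<^bsub>free_algebra V\<^esub> g) \<oplus>\<^bsub>free_algebra V\<^esub> g = f"
    using assms by algebra
  then show ?thesis by (auto simp: free_algebra_simps fun_eq_iff algebra_simps)
qed

lemma letter_carrier [simp]: "v \<in> V \<Longrightarrow> letter v \<in> carrier (free_algebra V)"
  by (auto simp: free_algebra_def letter_def split: if_splits)

text \<open>A word can be cut into \<open>u\<close> followed by \<open>v\<close> only after
  \<open>length u\<close> letters, so at most one summand of the convolution survives.\<close>

lemma free_algebra_monomial_mult:
  "(\<lambda>w. if w = u then c else 0) \<otimes>\<^bsub>free_algebra V\<^esub> (\<lambda>w. if w = v then d else 0)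
     = (\<lambda>w. if w = u @ v then c * d else 0)"
proof
  fix w
  have "(\<Sum>i\<le>length w. (if take i w = u then c else 0) * (if drop i w = v then d else 0)) =
     (\<Sum>i\<le>length w. if i = length u then if w = u @ v then c * d else 0 else 0)"
  proof (rule sum.cong[OF refl])
    fix i assume "i \<in> {..length w}"
    then have eq: "take i w = u \<and> drop i w = v \<longleftrightarrow> i = length u \<and> w = u @ v"
      by (metis append_eq_conv_conj append_take_drop_id atMost_iff length_take min.absorb2)
    have "(if take i w = u then c else 0) * (if drop i w = v then d else 0) =
        (if take i w = u \<and> drop i w = v then c * d else 0)"
      by simp
    also have "\<dots> = (if i = length u then if w = u @ v then c * d else 0 else 0)"
      unfolding eq by simp
    finally show "(if take i w = u then c else 0) * (if drop i w = v then d else 0) =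
        (if i = length u then if w = u @ v then c * d else 0 else 0)" .
  qed
  also have "\<dots> = (if w = u @ v then c * d else 0)"
    by simp
  finally show "((\<lambda>w. if w = u then c else 0) \<otimes>\<^bsub>free_algebra V\<^esub> (\<lambda>w. if w = v then d else 0)) w
     = (if w = u @ v then c * d else 0)"
    by (simp add: free_algebra_def)
qed

text \<open>Scalars become central ring elements, namely multiples of the empty word. Closure of the
  carrier and of ideals under scalars, and centrality of scalars, are thereby reduced to ring
  facts.\<close>

lemma free_algebra_scalar_mult:
  "(\<lambda>w. if w = [] then c else 0) \<otimes>\<^bsub>free_algebra V\<^esub> f = c \<odot>\<^bsub>free_algebra V\<^esub> f"
  "f \<otimes>\<^bsub>free_algebra V\<^esub> (\<lambda>w. if w = [] then c else 0) = c \<odot>\<^bsub>free_algebra V\<^esub> f"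
proof -
  have "(\<Sum>i\<le>length w. (if take i w = [] then c else 0) * f (drop i w)) =
      (\<Sum>i\<le>length w. if i = 0 then c * f w else 0)" for w
    by (rule sum.cong) auto
  moreover have "(\<Sum>i\<le>length w. f (take i w) * (if drop i w = [] then c else 0)) =
      (\<Sum>i\<le>length w. if i = length w then c * f w else 0)" for w
    by (rule sum.cong) auto
  ultimately show "(\<lambda>w. if w = [] then c else 0) \<otimes>\<^bsub>free_algebra V\<^esub> f = c \<odot>\<^bsub>free_algebra V\<^esub> f"
    "f \<otimes>\<^bsub>free_algebra V\<^esub> (\<lambda>w. if w = [] then c else 0) = c \<odot>\<^bsub>free_algebra V\<^esub> f"
    by (simp_all add: free_algebra_def cong: if_cong)
qed

lemma free_algebra_monomial_carrier:
  "set u \<subseteq> V \<Longrightarrow> (\<lambda>w. if w = u then c else 0) \<in> carrier (free_algebra V)"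
  by (auto simp: free_algebra_def)

lemma free_algebra_smult_closed:
  "f \<in> carrier (free_algebra V) \<Longrightarrow> c \<odot>\<^bsub>free_algebra V\<^esub> f \<in> carrier (free_algebra V)"
  unfolding free_algebra_scalar_mult(1)[symmetric]
  by (intro free_algebra_mult_closed free_algebra_monomial_carrier) auto

text \<open>Scalars and letters generate the free algebra: a monomial is a product of letters and a
  scalar, and a finitely supported function is a sum of monomials.\<close>

lemma free_algebra_induct [consumes 1, case_names scalar letter add mult]:
  fixes f :: "'v list \<Rightarrow> 'k::field"
  assumes f: "f \<in> carrier (free_algebra V)"
    and scalar: "\<And>c. P (\<lambda>w. if w = [] then c else 0)"
    and letter: "\<And>v. v \<in> V \<Longrightarrow> P (letter v)"
    and add: "\<And>f g. \<lbrakk>f \<in> carrier (free_algebra V); g \<in> carrier (free_algebra V); P f; P g\<rbrakk>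
       \<Longrightarrow> P (f \<oplus>\<^bsub>free_algebra V\<^esub> g)"
    and mult: "\<And>f g. \<lbrakk>f \<in> carrier (free_algebra V); g \<in> carrier (free_algebra V); P f; P g\<rbrakk>
       \<Longrightarrow> P (f \<otimes>\<^bsub>free_algebra V\<^esub> g)"
  shows "P f"
proof -
  have word: "P (\<lambda>w. if w = u then c else 0)" if "set u \<subseteq> V" for u and c :: 'k
    using that
  proof (induction u)
    case Nil
    then show ?case using scalar by simp
  next
    case (Cons v u)
    have v: "v \<in> V" and u: "set u \<subseteq> V" using Cons.prems by auto
    have "P (letter v \<otimes>\<^bsub>free_algebra V\<^esub> (\<lambda>w. if w = u then c else 0))"
      using letter_carrier[OF v] free_algebra_monomial_carrier[OF u] letter[OF v] Cons.IH[OF u]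
      by (rule mult)
    then show ?case unfolding letter_def free_algebra_monomial_mult mult_1 append.simps .
  qed
  \<comment> \<open>The induction runs over a finite set that contains the support, not over the
    support itself, so that splitting off the value at \<open>u\<close> works even when it is
    0.\<close>
  have supported: "P g" if "finite S" "S \<subseteq> lists V" "{w. g w \<noteq> 0} \<subseteq> S" for S and g :: "'v list \<Rightarrow> 'k"
    using that
  proof (induction S arbitrary: g)
    case empty
    then have "g = (\<lambda>w. 0)" by auto
    then show ?case using scalar[of 0] by simp
  next
    case (insert u S)
    have u: "set u \<subseteq> V" using insert.prems by auto
    have g: "(\<lambda>w. if w = u then g u else 0) \<oplus>\<^bsub>free_algebra V\<^esub> (g(u := 0)) = g"
      unfolding free_algebra_simps by (rule ext) simp
    have supp: "{w. (g(u := 0)) w \<noteq> 0} \<subseteq> S" using insert.prems by auto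
    have S: "S \<subseteq> lists V" using insert.prems(1) by blast
    have carr: "g(u := 0) \<in> carrier (free_algebra V)"
      unfolding free_algebra_def partial_object.simps mem_Collect_eq
      using finite_subset[OF supp insert.hyps(1)] order_trans[OF supp S] by (rule conjI)
    from S have "P (g(u := 0))" using supp by (rule insert.IH)
    then have "P ((\<lambda>w. if w = u then g u else 0) \<oplus>\<^bsub>free_algebra V\<^esub> (g(u := 0)))"
      by (rule add[OF free_algebra_monomial_carrier[OF u] carr word[OF u]])
    then show ?case unfolding g .
  qed
  have "finite {w. f w \<noteq> 0}" "{w. f w \<noteq> 0} \<subseteq> lists V"
    using f by (auto simp: free_algebra_def)
  then show ?thesis using subset_refl by (rule supported)
qed

lemma free_algebra_hom_commutative:
  assumes "ring_hom_ring (free_algebra V) S h"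
    and comm: "\<And>u v. \<lbrakk>u \<in> V; v \<in> V\<rbrakk>
      \<Longrightarrow> h (letter u) \<otimes>\<^bsub>S\<^esub> h (letter v) = h (letter v) \<otimes>\<^bsub>S\<^esub> h (letter u)"
    and f: "f \<in> carrier (free_algebra V)" and g: "g \<in> carrier (free_algebra V)"
  shows "h f \<otimes>\<^bsub>S\<^esub> h g = h g \<otimes>\<^bsub>S\<^esub> h f"
proof -
  interpret h: ring_hom_ring "free_algebra V" S h by fact
  \<comment> \<open>The elements commuting with a fixed \<open>s\<close> form a subring; if it
    contains the images of the letters, it contains the whole image of \<open>h\<close>.\<close>
  have *: "h f \<otimes>\<^bsub>S\<^esub> s = s \<otimes>\<^bsub>S\<^esub> h f"
    if "f \<in> carrier (free_algebra V)" and s: "s \<in> h ` carrier (free_algebra V)"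
      and sv: "\<And>v. v \<in> V \<Longrightarrow> h (letter v) \<otimes>\<^bsub>S\<^esub> s = s \<otimes>\<^bsub>S\<^esub> h (letter v)" for s f
    using that(1)
  proof (induction f rule: free_algebra_induct)
    case (scalar c)
    \<comment> \<open>\<open>S\<close> is a mere ring without scalars, so the centrality of a scalar
      is used in the free algebra before \<open>h\<close> is applied. This is why \<open>s\<close>
      is taken from the image of \<open>h\<close>.\<close>
    obtain g where g: "g \<in> carrier (free_algebra V)" "s = h g" using s by blast
    have "(\<lambda>w. if w = [] then c else 0) \<in> carrier (free_algebra V)"
      by (rule free_algebra_monomial_carrier) simp
    then show ?case
      using g by (simp only: h.hom_mult[symmetric] free_algebra_scalar_mult)
  next
    case (letter v)
    then show ?case by (rule sv)
  next
    case (add f g)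
    moreover have "s \<in> carrier S" using s by auto
    ultimately show ?case by (simp only: h.hom_add h.hom_closed h.S.l_distr h.S.r_distr)
  next
    case (mult f g)
    have sc: "s \<in> carrier S" using s by auto
    have "h f \<otimes>\<^bsub>S\<^esub> h g \<otimes>\<^bsub>S\<^esub> s = h f \<otimes>\<^bsub>S\<^esub> (s \<otimes>\<^bsub>S\<^esub> h g)"
      using mult sc by (simp only: h.S.m_assoc h.hom_closed)
    also have "\<dots> = s \<otimes>\<^bsub>S\<^esub> h f \<otimes>\<^bsub>S\<^esub> h g"
      using mult sc by (simp only: h.S.m_assoc[symmetric] h.hom_closed)
    finally show ?case using mult sc by (simp only: h.hom_mult h.S.m_assoc h.hom_closed)
  qed
  \<comment> \<open>First use of the commutant argument, with the image of a letter as the fixed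
    element; the second use fixes \<open>h g\<close> itself.\<close>
  have "h (letter v) \<otimes>\<^bsub>S\<^esub> h g = h g \<otimes>\<^bsub>S\<^esub> h (letter v)" if v: "v \<in> V" for v
    by (rule *[OF g imageI[OF letter_carrier[OF v]], symmetric]) (rule comm[OF _ v])
  then show ?thesis by (rule *[OF f imageI[OF g]])
qed

text \<open>Scalar multiplication of a coset is a union over its members. Two members differ by an
  element of \<open>I\<close>, and \<open>I\<close> is closed under scalars because a scalar acts as
  a multiple of the empty word, so all members give the same coset.\<close>

lemma quotient_free_algebra_smult:
  assumes "ideal I (free_algebra V)" "f \<in> carrier (free_algebra V)"
  shows "c \<odot>\<^bsub>quotient_algebra (free_algebra V) I\<^esub> (I +>\<^bsub>free_algebra V\<^esub> f)
    = I +>\<^bsub>free_algebra V\<^esub> (c \<odot>\<^bsub>free_algebra V\<^esub> f)"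
proof -
  interpret I: ideal I "free_algebra V" by fact
  have "I +>\<^bsub>free_algebra V\<^esub> (c \<odot>\<^bsub>free_algebra V\<^esub> x) = I +>\<^bsub>free_algebra V\<^esub> (c \<odot>\<^bsub>free_algebra V\<^esub> f)"
    if x: "x \<in> I +>\<^bsub>free_algebra V\<^esub> f" for x
  proof -
    obtain i where i: "i \<in> I" "x = i \<oplus>\<^bsub>free_algebra V\<^esub> f"
      using x by (auto simp: a_r_coset_def')
    have ic: "i \<in> carrier (free_algebra V)" by (rule I.a_Hcarr[OF i(1)])
    have xc: "x \<in> carrier (free_algebra V)" using i ic assms by simp
    have "c \<odot>\<^bsub>free_algebra V\<^esub> i \<in> I"
      unfolding free_algebra_scalar_mult(1)[symmetric]
      using i by (intro I.I_l_closed free_algebra_monomial_carrier) auto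
    moreover have "(c \<odot>\<^bsub>free_algebra V\<^esub> x) \<ominus>\<^bsub>free_algebra V\<^esub> (c \<odot>\<^bsub>free_algebra V\<^esub> f) = c \<odot>\<^bsub>free_algebra V\<^esub> i"
      unfolding free_algebra_minus[OF free_algebra_smult_closed[OF xc]
          free_algebra_smult_closed[OF assms(2)]]
      by (simp add: i(2) free_algebra_simps algebra_simps)
    ultimately show ?thesis
      using assms xc
      by (intro quotient_algebra_eqI free_algebra_smult_closed) auto
  qed
  \<comment> \<open>A constant union has the value of its members only if the index set is
    nonempty.\<close>
  moreover have "I +>\<^bsub>free_algebra V\<^esub> f \<noteq> {}" using I.a_rcos_self[OF assms(2)] by blast
  ultimately have "(\<Union>x\<in>I +>\<^bsub>free_algebra V\<^esub> f. I +>\<^bsub>free_algebra V\<^esub> (c \<odot>\<^bsub>free_algebra V\<^esub> x))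
      = I +>\<^bsub>free_algebra V\<^esub> (c \<odot>\<^bsub>free_algebra V\<^esub> f)"
    by (intro SUP_eq_const)
  then show ?thesis by (simp only: quotient_algebra_def module.simps)
qed

section \<open>The enveloping algebra\<close>

context superalgebra
begin

abbreviation "V \<equiv> supercarrier A"
abbreviation "F \<equiv> free_algebra V :: ('k, 'v list \<Rightarrow> 'k) module"
abbreviation "L \<equiv> linearity_ideal scale V"
abbreviation "T \<equiv> tensor_algebra scale V"
abbreviation "\<iota> \<equiv> tensor_emb scale V"
abbreviation "E \<equiv> enveloping_ideal scale A m"
abbreviation "U \<equiv> enveloping_algebra scale A m"
abbreviation "J \<equiv> genideal T (G_relations scale A)"
abbreviation "G \<equiv> G_algebra scale A"

lemma zero_component: "0 \<in> A i"
  using subspace_component by (rule subspace_0)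

lemma even_supercarrier: "x \<in> A 0 \<Longrightarrow> x \<in> V"
  unfolding supercarrier_def using zero_component[of 1] by force

lemma odd_supercarrier: "x \<in> A 1 \<Longrightarrow> x \<in> V"
  unfolding supercarrier_def using zero_component[of 0] by force

lemma supercarrier_add:
  assumes "u \<in> V" "v \<in> V" shows "u + v \<in> V"
proof -
  obtain x y x' y' where "u = x + y" "v = x' + y'" "x \<in> A 0" "x' \<in> A 0" "y \<in> A 1" "y' \<in> A 1"
    using assms unfolding supercarrier_def by blast
  moreover from this have "u + v = (x + x') + (y + y')" by simp
  ultimately show ?thesis
    unfolding supercarrier_def using subspace_add[OF subspace_component] by blast
qed

lemma supercarrier_scale:
  assumes "u \<in> V" shows "scale c u \<in> V"
proof -
  obtain x y where "u = x + y" "x \<in> A 0" "y \<in> A 1"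
    using assms unfolding supercarrier_def by blast
  then show ?thesis
    unfolding supercarrier_def using subspace_scale[OF subspace_component] scale_right_distrib
    by blast
qed

text \<open>The generators of \<open>linearity_ideal\<close> are pointwise differences of functions;
  in ring form, homomorphisms and ideal membership apply to them.\<close>

lemma linearity_relation_add:
  assumes "x \<in> V" "y \<in> V"
  shows "(\<lambda>w. letter (x + y) w - letter x w - letter y w) = letter (x + y) \<ominus>\<^bsub>F\<^esub> (letter x \<oplus>\<^bsub>F\<^esub> letter y)"
proof -
  interpret F: ring F by (rule ring_free_algebra)
  have xy: "letter x \<oplus>\<^bsub>F\<^esub> letter y \<in> carrier F"
    using assms by (intro F.a_closed letter_carrier)
  show ?thesis
    unfolding free_algebra_minus[OF letter_carrier[OF supercarrier_add[OF assms]] xy]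
    by (simp add: free_algebra_simps algebra_simps)
qed

lemma linearity_relation_scale:
  assumes "x \<in> V"
  shows "(\<lambda>w. letter (scale c x) w - c * letter x w) = letter (scale c x) \<ominus>\<^bsub>F\<^esub> c \<odot>\<^bsub>F\<^esub> letter x"
  unfolding free_algebra_minus[OF letter_carrier[OF supercarrier_scale[OF assms]]
      free_algebra_smult_closed[OF letter_carrier[OF assms]]]
  by (simp add: free_algebra_simps)

lemma linearity_ideal_leI:
  assumes K: "ideal K F"
    and add: "\<And>x y. \<lbrakk>x \<in> V; y \<in> V\<rbrakk> \<Longrightarrow> letter (x + y) \<ominus>\<^bsub>F\<^esub> (letter x \<oplus>\<^bsub>F\<^esub> letter y) \<in> K"
    and scale: "\<And>c x. x \<in> V \<Longrightarrow> letter (scale c x) \<ominus>\<^bsub>F\<^esub> c \<odot>\<^bsub>F\<^esub> letter x \<in> K"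
  shows "L \<subseteq> K"
proof -
  interpret F: ring F by (rule ring_free_algebra)
  show ?thesis
    unfolding linearity_ideal_def using K
    by (rule F.genideal_minimal)
      (auto simp: linearity_relation_add linearity_relation_scale add scale)
qed

lemma linearity_relations:
  shows ideal_linearity_ideal: "ideal L F"
    and letter_add: "\<lbrakk>x \<in> V; y \<in> V\<rbrakk> \<Longrightarrow> letter (x + y) \<ominus>\<^bsub>F\<^esub> (letter x \<oplus>\<^bsub>F\<^esub> letter y) \<in> L"
proof -
  interpret F: ring F by (rule ring_free_algebra)
  let ?S = "{\<lambda>w. letter (x + y) w - letter x w - letter y w | x y. x \<in> V \<and> y \<in> V} \<union>
      {\<lambda>w. letter (scale c x) w - c * letter x w | c x. x \<in> V} :: ('v list \<Rightarrow> 'k) set"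
  have S: "?S \<subseteq> carrier F"
    by (auto simp: linearity_relation_add linearity_relation_scale intro!: F.minus_closed F.a_closed
        letter_carrier free_algebra_smult_closed supercarrier_add supercarrier_scale)
  then show "ideal L F" unfolding linearity_ideal_def by (rule F.genideal_ideal)
  show "letter (x + y) \<ominus>\<^bsub>F\<^esub> (letter x \<oplus>\<^bsub>F\<^esub> letter y) \<in> L" if "x \<in> V" "y \<in> V"
    unfolding linearity_ideal_def linearity_relation_add[OF that, symmetric] using that
    by (intro subsetD[OF F.genideal_self[OF S]]) blast
qed

lemma tensor_hom: "ring_hom_ring F T (\<lambda>f. L +>\<^bsub>F\<^esub> f)"
  unfolding tensor_algebra_def by (rule quotient_algebra_hom[OF ideal_linearity_ideal])

lemma ring_tensor_algebra: "ring T"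
  unfolding tensor_algebra_def by (rule ring_quotient_algebra[OF ideal_linearity_ideal])

lemma tensor_emb_carrier [simp]: "v \<in> V \<Longrightarrow> \<iota> v \<in> carrier T"
  unfolding tensor_algebra_def carrier_quotient_algebra tensor_emb_def by simp

lemma tensor_emb_add:
  assumes "u \<in> V" "v \<in> V" shows "\<iota> (u + v) = \<iota> u \<oplus>\<^bsub>T\<^esub> \<iota> v"
proof -
  interpret T: ring_hom_ring F T "\<lambda>f. L +>\<^bsub>F\<^esub> f" by (rule tensor_hom)
  have "\<iota> (u + v) = L +>\<^bsub>F\<^esub> (letter u \<oplus>\<^bsub>F\<^esub> letter v)"
    unfolding tensor_emb_def using assms letter_add[OF assms]
    by (intro quotient_algebra_eqI[OF ideal_linearity_ideal])
      (auto intro!: T.R.a_closed letter_carrier supercarrier_add)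
  also have "\<dots> = \<iota> u \<oplus>\<^bsub>T\<^esub> \<iota> v"
    unfolding tensor_emb_def using assms by (intro T.hom_add letter_carrier)
  finally show ?thesis .
qed

text \<open>The second fact clears the factor 1/2 of the enveloping relations by adding an element
  to itself, which leaves pure ring equations. The condition on 2 matters: in characteristic 2 the
  value of \<open>1/2\<close> is 0, and the sum of two zeros is \<open>X\<close> only for zero
  \<open>X\<close>.\<close>

lemma tensor_smult:
  assumes "X \<in> carrier T"
  shows tensor_smult_closed: "c \<odot>\<^bsub>T\<^esub> X \<in> carrier T"
    and tensor_half: "(2::'k) \<noteq> 0 \<Longrightarrow> (1/2) \<odot>\<^bsub>T\<^esub> X \<oplus>\<^bsub>T\<^esub> (1/2) \<odot>\<^bsub>T\<^esub> X = X"
proof -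
  interpret T: ring_hom_ring F T "\<lambda>f. L +>\<^bsub>F\<^esub> f" by (rule tensor_hom)
  obtain f where f: "f \<in> carrier F" "X = L +>\<^bsub>F\<^esub> f"
    using assms unfolding tensor_algebra_def carrier_quotient_algebra by blast
  have smult: "c \<odot>\<^bsub>T\<^esub> X = L +>\<^bsub>F\<^esub> (c \<odot>\<^bsub>F\<^esub> f)" for c
    unfolding tensor_algebra_def f(2)
    by (rule quotient_free_algebra_smult[OF ideal_linearity_ideal f(1)])
  show "c \<odot>\<^bsub>T\<^esub> X \<in> carrier T"
    unfolding smult by (intro T.hom_closed free_algebra_smult_closed f(1))
  assume two: "(2::'k) \<noteq> 0"
  have "1/2 * x + 1/2 * x = x" for x :: 'k
    using two by (simp add: field_simps)
  then have "(1/2) \<odot>\<^bsub>F\<^esub> f \<oplus>\<^bsub>F\<^esub> (1/2) \<odot>\<^bsub>F\<^esub> f = f"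
    unfolding free_algebra_simps by (intro ext)
  then show "(1/2) \<odot>\<^bsub>T\<^esub> X \<oplus>\<^bsub>T\<^esub> (1/2) \<odot>\<^bsub>T\<^esub> X = X"
    unfolding smult unfolding f(2)
    using T.hom_add[OF free_algebra_smult_closed free_algebra_smult_closed, OF f(1) f(1), of "1/2" "1/2"]
    by argo
qed

lemma product_supercarrier:
  "\<lbrakk>x \<in> A 0; y \<in> A 0\<rbrakk> \<Longrightarrow> m x y \<in> V"
  "\<lbrakk>a \<in> A 1; x \<in> A 0\<rbrakk> \<Longrightarrow> m a x \<in> V"
  "\<lbrakk>a \<in> A 1; b \<in> A 1\<rbrakk> \<Longrightarrow> m a b \<in> V"
  using m_graded[of x 0 y 0] m_graded[of a 1 x 0] m_graded[of a 1 b 1]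
  by (simp_all add: even_supercarrier odd_supercarrier)

lemma enveloping_relations_carrier: "enveloping_relations scale A m \<subseteq> carrier T"
proof -
  interpret T: ring T by (rule ring_tensor_algebra)
  show ?thesis
    unfolding enveloping_relations_def Let_def
    by (auto simp: even_supercarrier odd_supercarrier product_supercarrier
        intro!: T.minus_closed T.a_closed T.m_closed tensor_smult_closed tensor_emb_carrier)
qed

lemma ideal_enveloping_ideal: "ideal E T"
  unfolding enveloping_ideal_def
  by (rule ring.genideal_ideal[OF ring_tensor_algebra enveloping_relations_carrier])

lemma enveloping_hom: "ring_hom_ring T U (\<lambda>t. E +>\<^bsub>T\<^esub> t)"
  unfolding enveloping_algebra_def by (rule quotient_algebra_hom[OF ideal_enveloping_ideal])

lemma ring_enveloping_algebra: "ring U"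
  unfolding enveloping_algebra_def by (rule ring_quotient_algebra[OF ideal_enveloping_ideal])

lemma enveloping_relation:
  assumes "r \<in> enveloping_relations scale A m" shows "r \<in> E"
  unfolding enveloping_ideal_def
  using ring.genideal_self[OF ring_tensor_algebra enveloping_relations_carrier] assms by blast

lemma enveloping_filtration_carrier: "enveloping_filtration scale A m n \<subseteq> carrier U"
  unfolding enveloping_filtration_def tensor_filtration_def enveloping_algebra_def
    tensor_algebra_def carrier_quotient_algebra by blast

section \<open>Relations between the generators of the enveloping algebra\<close>

definition enveloping_emb :: "'v \<Rightarrow> ('v list \<Rightarrow> 'k) set set" where
  "enveloping_emb v = E +>\<^bsub>T\<^esub> \<iota> v"

lemma enveloping_emb_carrier [simp]: "v \<in> V \<Longrightarrow> enveloping_emb v \<in> carrier U"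
  unfolding enveloping_emb_def enveloping_algebra_def carrier_quotient_algebra
  by (intro imageI tensor_emb_carrier)

lemma enveloping_emb_add:
  assumes "u \<in> V" "v \<in> V"
  shows "enveloping_emb (u + v) = enveloping_emb u \<oplus>\<^bsub>U\<^esub> enveloping_emb v"
  unfolding enveloping_emb_def tensor_emb_add[OF assms]
  using assms enveloping_hom
  by (simp add: abelian_group_hom.hom_add ring_hom_ring.axioms ring_hom_add ring_hom_ring.homh)

text \<open>Turns a vanishing product in the antialgebra into the zero of \<open>U\<close>; it
  follows from additivity at 0 + 0 by cancellation.\<close>

lemma enveloping_emb_zero: "enveloping_emb 0 = \<zero>\<^bsub>U\<^esub>"
proof -
  interpret U: ring U by (rule ring_enveloping_algebra)
  have V0: "0 \<in> V" by (rule even_supercarrier[OF zero_component])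
  then show ?thesis
    using enveloping_emb_add[OF V0 V0] U.add.l_cancel_one'[OF enveloping_emb_carrier enveloping_emb_carrier, of 0 0] by simp
qed

lemma enveloping_emb_even:
  assumes "x \<in> A 0" "y \<in> A 0"
  shows "enveloping_emb x \<otimes>\<^bsub>U\<^esub> enveloping_emb y = enveloping_emb (m x y)"
proof -
  interpret U: ring_hom_ring T U "\<lambda>t. E +>\<^bsub>T\<^esub> t" by (rule enveloping_hom)
  note V = assms[THEN even_supercarrier]
  have "\<iota> x \<otimes>\<^bsub>T\<^esub> \<iota> y \<ominus>\<^bsub>T\<^esub> \<iota> (m x y) \<in> E"
    by (rule enveloping_relation) (use assms in \<open>unfold enveloping_relations_def Let_def, blast\<close>)
  then have "E +>\<^bsub>T\<^esub> (\<iota> x \<otimes>\<^bsub>T\<^esub> \<iota> y) = enveloping_emb (m x y)"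
    unfolding enveloping_emb_def using assms V
    by (intro quotient_algebra_eqI[OF ideal_enveloping_ideal] U.R.m_closed tensor_emb_carrier
        product_supercarrier)
  then show ?thesis
    unfolding enveloping_emb_def U.hom_mult[OF V[THEN tensor_emb_carrier]] .
qed

text \<open>Modulo \<open>E\<close> each half of \<open>X\<close> equals \<iota> \<open>v\<close>,
  and the two halves add up to \<open>X\<close>. The doubled element is written as a sum, so only
  ring operations of \<open>U\<close> occur.\<close>

lemma enveloping_half_relation:
  assumes "(2::'k) \<noteq> 0" "X \<in> carrier T" "v \<in> V" "(1/2) \<odot>\<^bsub>T\<^esub> X \<ominus>\<^bsub>T\<^esub> \<iota> v \<in> E"
  shows "E +>\<^bsub>T\<^esub> X = enveloping_emb v \<oplus>\<^bsub>U\<^esub> enveloping_emb v"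
proof -
  interpret U: ring_hom_ring T U "\<lambda>t. E +>\<^bsub>T\<^esub> t" by (rule enveloping_hom)
  have half: "(1/2) \<odot>\<^bsub>T\<^esub> X \<in> carrier T" by (rule tensor_smult_closed[OF assms(2)])
  have "E +>\<^bsub>T\<^esub> (1/2) \<odot>\<^bsub>T\<^esub> X = enveloping_emb v"
    unfolding enveloping_emb_def
    using half tensor_emb_carrier[OF assms(3)] assms(4)
    by (rule quotient_algebra_eqI[OF ideal_enveloping_ideal])
  then show ?thesis
    using U.hom_add[OF half half] unfolding tensor_half[OF assms(2,1)] by argo
qed

lemma enveloping_emb_odd_even:
  assumes "(2::'k) \<noteq> 0" "a \<in> A 1" "x \<in> A 0"
  shows "enveloping_emb a \<otimes>\<^bsub>U\<^esub> enveloping_emb x \<oplus>\<^bsub>U\<^esub> enveloping_emb x \<otimes>\<^bsub>U\<^esub> enveloping_emb a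
    = enveloping_emb (m a x) \<oplus>\<^bsub>U\<^esub> enveloping_emb (m a x)"
proof -
  interpret U: ring_hom_ring T U "\<lambda>t. E +>\<^bsub>T\<^esub> t" by (rule enveloping_hom)
  have a: "\<iota> a \<in> carrier T" and x: "\<iota> x \<in> carrier T"
    using assms by (auto intro: tensor_emb_carrier even_supercarrier odd_supercarrier)
  let ?X = "\<iota> a \<otimes>\<^bsub>T\<^esub> \<iota> x \<oplus>\<^bsub>T\<^esub> \<iota> x \<otimes>\<^bsub>T\<^esub> \<iota> a"
  have "(1/2) \<odot>\<^bsub>T\<^esub> ?X \<ominus>\<^bsub>T\<^esub> \<iota> (m a x) \<in> E"
    by (rule enveloping_relation) (use assms in \<open>unfold enveloping_relations_def Let_def, blast\<close>)
  then have "E +>\<^bsub>T\<^esub> ?X = enveloping_emb (m a x) \<oplus>\<^bsub>U\<^esub> enveloping_emb (m a x)"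
    using assms a x by (intro enveloping_half_relation U.R.a_closed U.R.m_closed product_supercarrier)
  moreover have "E +>\<^bsub>T\<^esub> ?X = (E +>\<^bsub>T\<^esub> \<iota> a) \<otimes>\<^bsub>U\<^esub> (E +>\<^bsub>T\<^esub> \<iota> x) \<oplus>\<^bsub>U\<^esub> (E +>\<^bsub>T\<^esub> \<iota> x) \<otimes>\<^bsub>U\<^esub> (E +>\<^bsub>T\<^esub> \<iota> a)"
    using a x by (simp only: U.hom_add U.hom_mult U.R.m_closed)
  ultimately show ?thesis unfolding enveloping_emb_def by argo
qed

lemma enveloping_emb_odd_odd:
  assumes "(2::'k) \<noteq> 0" "a \<in> A 1" "b \<in> A 1"
  shows "enveloping_emb a \<otimes>\<^bsub>U\<^esub> enveloping_emb b \<ominus>\<^bsub>U\<^esub> enveloping_emb b \<otimes>\<^bsub>U\<^esub> enveloping_emb a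
    = enveloping_emb (m a b) \<oplus>\<^bsub>U\<^esub> enveloping_emb (m a b)"
proof -
  interpret U: ring_hom_ring T U "\<lambda>t. E +>\<^bsub>T\<^esub> t" by (rule enveloping_hom)
  have a: "\<iota> a \<in> carrier T" and b: "\<iota> b \<in> carrier T"
    using assms by (auto intro: tensor_emb_carrier odd_supercarrier)
  let ?X = "\<iota> a \<otimes>\<^bsub>T\<^esub> \<iota> b \<ominus>\<^bsub>T\<^esub> \<iota> b \<otimes>\<^bsub>T\<^esub> \<iota> a"
  have "(1/2) \<odot>\<^bsub>T\<^esub> ?X \<ominus>\<^bsub>T\<^esub> \<iota> (m a b) \<in> E"
    by (rule enveloping_relation) (use assms in \<open>unfold enveloping_relations_def Let_def, blast\<close>)
  then have "E +>\<^bsub>T\<^esub> ?X = enveloping_emb (m a b) \<oplus>\<^bsub>U\<^esub> enveloping_emb (m a b)"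
    using assms a b by (intro enveloping_half_relation U.R.minus_closed U.R.m_closed product_supercarrier)
  moreover have "E +>\<^bsub>T\<^esub> ?X = (E +>\<^bsub>T\<^esub> \<iota> a) \<otimes>\<^bsub>U\<^esub> (E +>\<^bsub>T\<^esub> \<iota> b) \<ominus>\<^bsub>U\<^esub> (E +>\<^bsub>T\<^esub> \<iota> b) \<otimes>\<^bsub>U\<^esub> (E +>\<^bsub>T\<^esub> \<iota> a)"
    using a b by (simp only: a_minus_def U.hom_add U.hom_mult U.hom_a_inv U.R.m_closed U.R.a_inv_closed)
  ultimately show ?thesis unfolding enveloping_emb_def by argo
qed

end

text \<open>The idempotent argument works for every even x once x is written as x e: moving an odd a
  past e and then past x changes the sign twice, and x e collapses back to x. Even elements commute
  with each other because their products are those of \<open>m\<close>, odd ones because their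
  commutator is twice \<open>m a b\<close>, which is 0.\<close>

lemma (in lie_antialgebra) enveloping_algebra_commutative:
  assumes two: "(2::'a) \<noteq> 0" and e: "e \<in> A 0" "\<And>x. x \<in> A 0 \<Longrightarrow> m x e = x"
    and odd_even: "\<And>a x. \<lbrakk>a \<in> A 1; x \<in> A 0\<rbrakk> \<Longrightarrow> m a x = 0"
    and odd_odd: "\<And>a b. \<lbrakk>a \<in> A 1; b \<in> A 1\<rbrakk> \<Longrightarrow> m a b = 0"
    and "s \<in> carrier U" "t \<in> carrier U"
  shows "s \<otimes>\<^bsub>U\<^esub> t = t \<otimes>\<^bsub>U\<^esub> s"
proof -
  interpret U: ring U by (rule ring_enveloping_algebra)
  let ?u = enveloping_emb
  have even_carrier: "?u x \<in> carrier U" if "x \<in> A 0" for x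
    by (rule enveloping_emb_carrier[OF even_supercarrier[OF that]])
  have odd_carrier: "?u x \<in> carrier U" if "x \<in> A 1" for x
    by (rule enveloping_emb_carrier[OF odd_supercarrier[OF that]])
  have even: "?u x \<otimes>\<^bsub>U\<^esub> ?u y = ?u y \<otimes>\<^bsub>U\<^esub> ?u x" if "x \<in> A 0" "y \<in> A 0" for x y
    using that supercommutative[of x 0 y 0] by (simp add: enveloping_emb_even)
  have odd: "?u a \<otimes>\<^bsub>U\<^esub> ?u b = ?u b \<otimes>\<^bsub>U\<^esub> ?u a" if "a \<in> A 1" "b \<in> A 1" for a b
  proof -
    have "?u a \<otimes>\<^bsub>U\<^esub> ?u b \<ominus>\<^bsub>U\<^esub> ?u b \<otimes>\<^bsub>U\<^esub> ?u a = \<zero>\<^bsub>U\<^esub>"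
      using enveloping_emb_odd_odd[OF two that]
      unfolding odd_odd[OF that] enveloping_emb_zero U.l_zero[OF U.zero_closed] .
    then show ?thesis
      by (rule iffD1[OF U.r_right_minus_eq, rotated 2]) (intro U.m_closed odd_carrier that)+
  qed
  have anticommute: "?u x \<otimes>\<^bsub>U\<^esub> ?u a = \<ominus>\<^bsub>U\<^esub> (?u a \<otimes>\<^bsub>U\<^esub> ?u x)" if "x \<in> A 0" "a \<in> A 1" for x a
  proof -
    have "?u a \<otimes>\<^bsub>U\<^esub> ?u x \<oplus>\<^bsub>U\<^esub> ?u x \<otimes>\<^bsub>U\<^esub> ?u a = \<zero>\<^bsub>U\<^esub>"
      using enveloping_emb_odd_even[OF two that(2,1)]
      unfolding odd_even[OF that(2,1)] enveloping_emb_zero U.l_zero[OF U.zero_closed] .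
    then have "?u x \<otimes>\<^bsub>U\<^esub> ?u a \<oplus>\<^bsub>U\<^esub> ?u a \<otimes>\<^bsub>U\<^esub> ?u x = \<zero>\<^bsub>U\<^esub>"
      by (subst U.a_comm) (intro U.m_closed even_carrier[OF that(1)] odd_carrier[OF that(2)])+
    then show ?thesis
      using even_carrier[OF that(1)] odd_carrier[OF that(2)]
      by (intro U.minus_equality[symmetric] U.m_closed)
  qed
  have mixed: "?u x \<otimes>\<^bsub>U\<^esub> ?u a = ?u a \<otimes>\<^bsub>U\<^esub> ?u x" if x: "x \<in> A 0" and a: "a \<in> A 1" for x a
  proof -
    note carr = even_carrier[OF x] even_carrier[OF e(1)] odd_carrier[OF a]
    have xe: "?u x = ?u x \<otimes>\<^bsub>U\<^esub> ?u e" using enveloping_emb_even[OF x e(1)] e(2)[OF x] by simp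
    have "?u x \<otimes>\<^bsub>U\<^esub> ?u a = ?u x \<otimes>\<^bsub>U\<^esub> (?u e \<otimes>\<^bsub>U\<^esub> ?u a)"
      using U.m_assoc[OF carr] unfolding xe[symmetric] .
    also have "\<dots> = \<ominus>\<^bsub>U\<^esub> (?u x \<otimes>\<^bsub>U\<^esub> ?u a) \<otimes>\<^bsub>U\<^esub> ?u e"
      unfolding anticommute[OF e(1) a] using carr by (simp only: U.r_minus U.l_minus U.m_assoc U.m_closed)
    also have "\<dots> = ?u a \<otimes>\<^bsub>U\<^esub> (?u x \<otimes>\<^bsub>U\<^esub> ?u e)"
      unfolding anticommute[OF x a] using carr by (simp only: U.minus_minus U.m_assoc U.m_closed)
    finally show ?thesis unfolding xe[symmetric] .
  qed
  \<comment> \<open>The letters of the free algebra are all vectors of the supercarrier, not only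
    homogeneous ones, so the four homogeneous cases are combined by distributivity.\<close>
  have V: "?u u \<otimes>\<^bsub>U\<^esub> ?u v = ?u v \<otimes>\<^bsub>U\<^esub> ?u u" if "u \<in> V" "v \<in> V" for u v
  proof -
    obtain x a y b where u: "u = x + a" "x \<in> A 0" "a \<in> A 1" and v: "v = y + b" "y \<in> A 0" "b \<in> A 1"
      using \<open>u \<in> V\<close> \<open>v \<in> V\<close> unfolding supercarrier_def by blast
    have sum: "?u u = ?u x \<oplus>\<^bsub>U\<^esub> ?u a" "?u v = ?u y \<oplus>\<^bsub>U\<^esub> ?u b"
      unfolding u(1) v(1)
      by (rule enveloping_emb_add[OF even_supercarrier odd_supercarrier]; fact)+
    have distrib: "(p \<oplus>\<^bsub>U\<^esub> q) \<otimes>\<^bsub>U\<^esub> (p' \<oplus>\<^bsub>U\<^esub> q') = (p' \<oplus>\<^bsub>U\<^esub> q') \<otimes>\<^bsub>U\<^esub> (p \<oplus>\<^bsub>U\<^esub> q)"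
      if carr: "p \<in> carrier U" "q \<in> carrier U" "p' \<in> carrier U" "q' \<in> carrier U"
        and comm: "p \<otimes>\<^bsub>U\<^esub> p' = p' \<otimes>\<^bsub>U\<^esub> p" "p \<otimes>\<^bsub>U\<^esub> q' = q' \<otimes>\<^bsub>U\<^esub> p"
          "q \<otimes>\<^bsub>U\<^esub> p' = p' \<otimes>\<^bsub>U\<^esub> q" "q \<otimes>\<^bsub>U\<^esub> q' = q' \<otimes>\<^bsub>U\<^esub> q" for p q p' q'
    proof -
      have "(p \<oplus>\<^bsub>U\<^esub> q) \<otimes>\<^bsub>U\<^esub> (p' \<oplus>\<^bsub>U\<^esub> q')
          = (p' \<otimes>\<^bsub>U\<^esub> p \<oplus>\<^bsub>U\<^esub> q' \<otimes>\<^bsub>U\<^esub> p) \<oplus>\<^bsub>U\<^esub> (p' \<otimes>\<^bsub>U\<^esub> q \<oplus>\<^bsub>U\<^esub> q' \<otimes>\<^bsub>U\<^esub> q)"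
        unfolding comm[symmetric] U.l_distr[OF carr(1,2) U.a_closed[OF carr(3,4)]]
        using carr by (simp only: U.r_distr)
      also have "\<dots> = (p' \<oplus>\<^bsub>U\<^esub> q') \<otimes>\<^bsub>U\<^esub> (p \<oplus>\<^bsub>U\<^esub> q)"
        unfolding U.r_distr[OF carr(1,2) U.a_closed[OF carr(3,4)]]
        using carr by (simp only: U.l_distr)
      finally show ?thesis .
    qed
    show ?thesis
      unfolding sum
      using even_carrier[OF u(2)] odd_carrier[OF u(3)] even_carrier[OF v(2)] odd_carrier[OF v(3)]
        even[OF u(2) v(2)] mixed[OF u(2) v(3)] mixed[OF v(2) u(3), symmetric] odd[OF u(3) v(3)]
      by (rule distrib)
  qed
  \<comment> \<open>\<open>U\<close> is the image of the free algebra under the two quotient maps,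
    so it is commutative as soon as the images of letters commute.\<close>
  let ?\<psi> = "\<lambda>f. E +>\<^bsub>T\<^esub> (L +>\<^bsub>F\<^esub> f)"
  have "?\<psi> \<in> ring_hom F U"
    using ring_hom_trans[OF ring_hom_ring.homh[OF tensor_hom] ring_hom_ring.homh[OF enveloping_hom]]
    by (simp add: comp_def)
  then have \<psi>: "ring_hom_ring F U ?\<psi>"
    by (rule ring_hom_ringI2[OF ring_free_algebra ring_enveloping_algebra])
  obtain f g where "f \<in> carrier F" "g \<in> carrier F" and st: "s = ?\<psi> f" "t = ?\<psi> g"
    using assms(6,7)
    unfolding enveloping_algebra_def tensor_algebra_def carrier_quotient_algebra by blast
  then show ?thesis
    unfolding st
    by (intro free_algebra_hom_commutative[OF \<psi> V[unfolded enveloping_emb_def tensor_emb_def]])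
qed

section \<open>The algebra \<open>G\<close>\<close>

context superalgebra
begin

lemma G_relations_carrier: "G_relations scale A \<subseteq> carrier T"
proof -
  interpret T: ring T by (rule ring_tensor_algebra)
  show ?thesis
    unfolding G_relations_def Let_def
    by (auto simp: even_supercarrier odd_supercarrier
        intro!: T.minus_closed T.a_closed T.m_closed tensor_emb_carrier)
qed

lemma ideal_G_ideal: "ideal J T"
  by (rule ring.genideal_ideal[OF ring_tensor_algebra G_relations_carrier])

text \<open>Universal property of \<open>G\<close>, starting from the free algebra. A generated
  ideal lies in a kernel as soon as its generators do, so only letters need checking. As
  \<open>S\<close> is a mere ring, compatibility with scalars is expressed through \<open>h\<close>
  of a scaled letter.\<close>

lemma G_algebra_lift:
  assumes "ring_hom_ring F S h"
    and add: "\<And>x y. \<lbrakk>x \<in> V; y \<in> V\<rbrakk> \<Longrightarrow> h (letter (x + y)) = h (letter x) \<oplus>\<^bsub>S\<^esub> h (letter y)"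
    and scale: "\<And>c x. x \<in> V \<Longrightarrow> h (letter (scale c x)) = h (c \<odot>\<^bsub>F\<^esub> letter x)"
    and odd: "\<And>a b. \<lbrakk>a \<in> A 1; b \<in> A 1\<rbrakk>
      \<Longrightarrow> h (letter a) \<otimes>\<^bsub>S\<^esub> h (letter b) = h (letter b) \<otimes>\<^bsub>S\<^esub> h (letter a)"
    and odd_even: "\<And>a x. \<lbrakk>a \<in> A 1; x \<in> A 0\<rbrakk>
      \<Longrightarrow> h (letter a) \<otimes>\<^bsub>S\<^esub> h (letter x) \<oplus>\<^bsub>S\<^esub> h (letter x) \<otimes>\<^bsub>S\<^esub> h (letter a) = \<zero>\<^bsub>S\<^esub>"
    and even: "\<And>x y. \<lbrakk>x \<in> A 0; y \<in> A 0\<rbrakk> \<Longrightarrow> h (letter x) \<otimes>\<^bsub>S\<^esub> h (letter y) = \<zero>\<^bsub>S\<^esub>"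
  obtains h' where "ring_hom_ring G S h'" "\<And>v. v \<in> V \<Longrightarrow> h' (J +>\<^bsub>T\<^esub> \<iota> v) = h (letter v)"
proof -
  interpret h: ring_hom_ring F S h by fact
  have hsub: "h (f \<ominus>\<^bsub>F\<^esub> g) = h f \<ominus>\<^bsub>S\<^esub> h g" if "f \<in> carrier F" "g \<in> carrier F" for f g
    unfolding a_minus_def using that by (simp only: h.hom_add h.hom_a_inv h.R.a_inv_closed)
  have minus_self: "s \<ominus>\<^bsub>S\<^esub> s = \<zero>\<^bsub>S\<^esub>" if "s \<in> carrier S" for s
    unfolding a_minus_def using that by (rule h.S.r_neg)
  have kerI: "f \<ominus>\<^bsub>F\<^esub> g \<in> a_kernel F S h" if "f \<in> carrier F" "g \<in> carrier F" "h f = h g" for f g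
    unfolding a_kernel_def'
    using that h.R.minus_closed[OF that(1,2)] hsub[OF that(1,2)] minus_self[OF h.hom_closed[OF that(2)]]
    by auto
  \<comment> \<open>First descent, from words to tensors; the relations of \<open>G\<close> are then
    treated in the tensor algebra with the induced map \<open>k\<close>.\<close>
  have "L \<subseteq> a_kernel F S h"
  proof (rule linearity_ideal_leI[OF h.kernel_is_ideal])
    fix x y assume xy: "x \<in> V" "y \<in> V"
    show "letter (x + y) \<ominus>\<^bsub>F\<^esub> (letter x \<oplus>\<^bsub>F\<^esub> letter y) \<in> a_kernel F S h"
      using xy h.hom_add[OF letter_carrier letter_carrier] add
      by (intro kerI letter_carrier supercarrier_add h.R.a_closed) auto
  next
    fix c x assume x: "x \<in> V"
    show "letter (scale c x) \<ominus>\<^bsub>F\<^esub> c \<odot>\<^bsub>F\<^esub> letter x \<in> a_kernel F S h"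
      using x by (intro kerI letter_carrier supercarrier_scale free_algebra_smult_closed scale)
  qed
  then obtain k where k: "ring_hom_ring T S k"
    and kL: "\<And>f. f \<in> carrier F \<Longrightarrow> k (L +>\<^bsub>F\<^esub> f) = h f"
    using quotient_algebra_lift[OF ideal_linearity_ideal assms(1)]
    unfolding tensor_algebra_def by blast
  interpret k: ring_hom_ring T S k by fact
  have ke: "k (\<iota> x) = h (letter x)" "\<iota> x \<in> carrier T" "h (letter x) \<in> carrier S" if "x \<in> A 0" for x
    using that even_supercarrier[OF that] kL[OF letter_carrier] unfolding tensor_emb_def[symmetric] by auto
  have ko: "k (\<iota> x) = h (letter x)" "\<iota> x \<in> carrier T" "h (letter x) \<in> carrier S" if "x \<in> A 1" for x
    using that odd_supercarrier[OF that] kL[OF letter_carrier] unfolding tensor_emb_def[symmetric] by auto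
  have "G_relations scale A \<subseteq> a_kernel T S k"
  proof -
    have "k (\<iota> a \<otimes>\<^bsub>T\<^esub> \<iota> b \<ominus>\<^bsub>T\<^esub> \<iota> b \<otimes>\<^bsub>T\<^esub> \<iota> a) = \<zero>\<^bsub>S\<^esub>" if "a \<in> A 1" "b \<in> A 1" for a b
    proof -
      have "k (\<iota> a \<otimes>\<^bsub>T\<^esub> \<iota> b \<ominus>\<^bsub>T\<^esub> \<iota> b \<otimes>\<^bsub>T\<^esub> \<iota> a) =
          h (letter a) \<otimes>\<^bsub>S\<^esub> h (letter b) \<ominus>\<^bsub>S\<^esub> h (letter b) \<otimes>\<^bsub>S\<^esub> h (letter a)"
        unfolding a_minus_def using that
        by (simp only: k.hom_add k.hom_mult k.hom_a_inv k.R.a_inv_closed k.R.m_closed ko)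
      also have "\<dots> = \<zero>\<^bsub>S\<^esub>"
        unfolding odd[OF that] by (intro minus_self h.S.m_closed ko that)
      finally show ?thesis .
    qed
    moreover have "k (\<iota> a \<otimes>\<^bsub>T\<^esub> \<iota> x \<oplus>\<^bsub>T\<^esub> \<iota> x \<otimes>\<^bsub>T\<^esub> \<iota> a) = \<zero>\<^bsub>S\<^esub>" if "a \<in> A 1" "x \<in> A 0" for a x
      using that odd_even[OF that] by (simp only: k.hom_add k.hom_mult k.R.m_closed ko ke)
    moreover have "k (\<iota> x \<otimes>\<^bsub>T\<^esub> \<iota> y) = \<zero>\<^bsub>S\<^esub>" if "x \<in> A 0" "y \<in> A 0" for x y
      using that even[OF that] by (simp only: k.hom_mult ke)
    ultimately have "k r = \<zero>\<^bsub>S\<^esub>" if "r \<in> G_relations scale A" for r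
      using that unfolding G_relations_def Let_def by blast
    then show ?thesis unfolding a_kernel_def' using G_relations_carrier by blast
  qed
  then have "J \<subseteq> a_kernel T S k"
    by (rule k.R.genideal_minimal[OF k.kernel_is_ideal])
  then obtain h' where "ring_hom_ring G S h'"
    and h': "\<And>t. t \<in> carrier T \<Longrightarrow> h' (J +>\<^bsub>T\<^esub> t) = k t"
    using quotient_algebra_lift[OF ideal_G_ideal k] unfolding G_algebra_def Let_def by blast
  moreover have "h' (J +>\<^bsub>T\<^esub> \<iota> v) = h (letter v)" if "v \<in> V" for v
    unfolding h'[OF tensor_emb_carrier[OF that]] unfolding tensor_emb_def
    by (rule kL[OF letter_carrier[OF that]])
  ultimately show ?thesis using that by blast
qed

lemma G_algebra_carrier: "v \<in> V \<Longrightarrow> J +>\<^bsub>T\<^esub> \<iota> v \<in> carrier G"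
  unfolding G_algebra_def Let_def carrier_quotient_algebra by (intro imageI tensor_emb_carrier)

end

section \<open>A representation by triangular matrices\<close>

definition pairing :: "('v list \<Rightarrow> 'k) \<Rightarrow> ('v list \<Rightarrow> 'k::field) \<Rightarrow> 'k" where
  "pairing \<kappa> f = (\<Sum>w | f w \<noteq> 0. f w * \<kappa> w)"

lemma pairing_eq:
  assumes "finite S" "{w. f w \<noteq> 0} \<subseteq> S" shows "pairing \<kappa> f = (\<Sum>w\<in>S. f w * \<kappa> w)"
  unfolding pairing_def using assms by (intro sum.mono_neutral_left) auto

lemma finite_support: "f \<in> carrier (free_algebra V) \<Longrightarrow> finite {w. f w \<noteq> 0}"
  by (simp add: free_algebra_def)

lemma pairing_add:
  assumes "f \<in> carrier (free_algebra V)" "g \<in> carrier (free_algebra V)"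
  shows "pairing \<kappa> (f \<oplus>\<^bsub>free_algebra V\<^esub> g) = pairing \<kappa> f + pairing \<kappa> g"
proof -
  let ?S = "{w. f w \<noteq> 0} \<union> {w. g w \<noteq> 0}"
  have S: "finite ?S" using assms[THEN finite_support] by simp
  have "pairing \<kappa> (f \<oplus>\<^bsub>free_algebra V\<^esub> g) = (\<Sum>w\<in>?S. (f w + g w) * \<kappa> w)"
    unfolding free_algebra_simps by (rule pairing_eq[OF S]) auto
  also have "\<dots> = pairing \<kappa> f + pairing \<kappa> g"
    unfolding pairing_eq[OF S Un_upper1] pairing_eq[OF S Un_upper2]
    by (simp add: distrib_right sum.distrib)
  finally show ?thesis .
qed

lemma pairing_smult: "pairing \<kappa> (c \<odot>\<^bsub>free_algebra V\<^esub> f) = c * pairing \<kappa> f"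
  \<comment> \<open>For c = 0 the support becomes empty; otherwise scaling leaves it
    unchanged.\<close>
  by (cases "c = 0") (simp_all add: pairing_def free_algebra_simps sum_distrib_left mult.assoc)

lemma pairing_scalar: "pairing \<kappa> (\<lambda>w. if w = [] then c else 0) = c * \<kappa> []"
  by (subst pairing_eq[of "{[]}"]) auto

lemma pairing_letter: "pairing \<kappa> (letter v) = \<kappa> [v]"
  by (subst pairing_eq[of "{[v]}"]) (auto simp: letter_def)

text \<open>Linearity in the functional, with \<open>f\<close> and hence the summation range fixed.
  It splits the recursive equation of \<open>corner\<close> into its two terms.\<close>

lemma pairing_linear: "pairing (\<lambda>w. c * \<kappa> w + d * \<kappa>' w) f = c * pairing \<kappa> f + d * pairing \<kappa>' f"
  by (simp add: pairing_def sum_distrib_left algebra_simps sum.distrib)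

text \<open>Left multiplication by \<open>v\<close> moves the coefficient of each word
  \<open>w\<close> to \<open>v # w\<close>; on functionals the adjoint operation is precomposition
  with \<open>Cons v\<close>. This matches functionals defined by recursion from the left.\<close>

lemma pairing_letter_mult:
  assumes "g \<in> carrier (free_algebra V)"
  shows "pairing \<kappa> (letter v \<otimes>\<^bsub>free_algebra V\<^esub> g) = pairing (\<lambda>w. \<kappa> (v # w)) g"
proof -
  have eval: "(letter v \<otimes>\<^bsub>free_algebra V\<^esub> g) w = (if w \<noteq> [] \<and> hd w = v then g (tl w) else 0)" for w
  proof -
    have "(\<Sum>i\<le>length w. letter v (take i w) * g (drop i w)) =
        (\<Sum>i\<le>length w. if i = 1 then if w \<noteq> [] \<and> hd w = v then g (tl w) else 0 else 0)"
    proof (rule sum.cong[OF refl])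
      fix i assume "i \<in> {..length w}"
      then show "letter v (take i w) * g (drop i w) =
          (if i = 1 then if w \<noteq> [] \<and> hd w = v then g (tl w) else 0 else 0)"
        by (cases w; cases i) (auto simp: letter_def)
    qed
    also have "\<dots> = (if w \<noteq> [] \<and> hd w = v then g (tl w) else 0)"
      by (cases w) (simp_all add: Suc_le_eq)
    finally show ?thesis by (simp add: free_algebra_def)
  qed
  have "pairing \<kappa> (letter v \<otimes>\<^bsub>free_algebra V\<^esub> g) =
      (\<Sum>w\<in>Cons v ` {w. g w \<noteq> 0}. (letter v \<otimes>\<^bsub>free_algebra V\<^esub> g) w * \<kappa> w)"
  proof (rule pairing_eq)
    show "{w. (letter v \<otimes>\<^bsub>free_algebra V\<^esub> g) w \<noteq> 0} \<subseteq> Cons v ` {w. g w \<noteq> 0}"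
    proof
      fix w assume "w \<in> {w. (letter v \<otimes>\<^bsub>free_algebra V\<^esub> g) w \<noteq> 0}"
      then show "w \<in> Cons v ` {w. g w \<noteq> 0}"
        by (cases w) (auto simp: eval split: if_splits)
    qed
  qed (use finite_support[OF assms] in simp)
  also have "\<dots> = pairing (\<lambda>w. \<kappa> (v # w)) g"
    by (subst sum.reindex) (auto simp: eval pairing_def)
  finally show ?thesis .
qed

text \<open>The triple \<open>(p, q, r)\<close> stands for the matrix with rows \<open>(p, q)\<close> and \<open>(0, r)\<close>.\<close>

definition triangular_ring :: "('k::field \<times> 'k \<times> 'k) ring" where
  "triangular_ring =
     \<lparr>carrier = UNIV,
      monoid.mult = (\<lambda>(p, q, r) (p', q', r'). (p * p', p * q' + q * r', r * r')),
      one = (1, 0, 1),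
      zero = (0, 0, 0),
      add = (\<lambda>(p, q, r) (p', q', r'). (p + p', q + q', r + r'))\<rparr>"

lemma ring_triangular_ring: "ring triangular_ring"
proof (rule ringI)
  show "abelian_group (triangular_ring :: ('k::field \<times> 'k \<times> 'k) ring)"
  proof (rule abelian_groupI)
    fix x :: "'k \<times> 'k \<times> 'k"
    obtain p q r where "x = (p, q, r)" by (cases x)
    then show "\<exists>y\<in>carrier triangular_ring. y \<oplus>\<^bsub>triangular_ring\<^esub> x = \<zero>\<^bsub>triangular_ring\<^esub>"
      by (intro bexI[of _ "(- p, - q, - r)"]) (auto simp: triangular_ring_def)
  qed (auto simp: triangular_ring_def)
  show "monoid (triangular_ring :: ('k::field \<times> 'k \<times> 'k) ring)"
    by (rule monoidI) (auto simp: triangular_ring_def algebra_simps)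
qed (auto simp: triangular_ring_def algebra_simps)

text \<open>Entries of the product of the matrices with rows \<open>(v 1, v 0)\<close> and \<open>(0, - v 1)\<close> over the
  letters \<open>v\<close> of a word.\<close>

fun diag1 diag2 corner :: "(nat \<Rightarrow> 'k::field) list \<Rightarrow> 'k" where
  "diag1 [] = 1"
| "diag1 (v # w) = v 1 * diag1 w"
| "diag2 [] = 1"
| "diag2 (v # w) = - v 1 * diag2 w"
| "corner [] = 0"
| "corner (v # w) = v 1 * corner w + v 0 * diag2 w"

definition triangular_rep :: "((nat \<Rightarrow> 'k::field) list \<Rightarrow> 'k) \<Rightarrow> 'k \<times> 'k \<times> 'k" where
  "triangular_rep f = (pairing diag1 f, pairing corner f, pairing diag2 f)"

lemma triangular_rep_letter: "triangular_rep (letter v) = (v 1, v 0, - v 1)"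
  by (simp add: triangular_rep_def pairing_letter)

lemma triangular_rep_smult:
  "triangular_rep (c \<odot>\<^bsub>free_algebra V\<^esub> f)
    = (c * fst (triangular_rep f), c * fst (snd (triangular_rep f)), c * snd (snd (triangular_rep f)))"
  by (simp add: triangular_rep_def pairing_smult)

text \<open>Multiplicativity is shown by induction on the left factor: for a letter it is the
  recursion of the matrix entries, for sums and products it follows from distributivity and
  associativity in both rings.\<close>

lemma triangular_rep_hom: "ring_hom_ring (free_algebra V) triangular_ring triangular_rep"
proof (rule ring_hom_ringI)
  show "ring (free_algebra V :: ('a, (nat \<Rightarrow> 'a) list \<Rightarrow> 'a) module)" by (rule ring_free_algebra)
  show "ring (triangular_ring :: ('a \<times> 'a \<times> 'a) ring)" by (rule ring_triangular_ring)
next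
  fix f :: "(nat \<Rightarrow> 'a) list \<Rightarrow> 'a"
  show "triangular_rep f \<in> carrier triangular_ring" by (simp add: triangular_ring_def)
next
  fix f g :: "(nat \<Rightarrow> 'a) list \<Rightarrow> 'a"
  assume f: "f \<in> carrier (free_algebra V)" and g: "g \<in> carrier (free_algebra V)"
  have rep_add: "triangular_rep (f \<oplus>\<^bsub>free_algebra V\<^esub> g)
      = triangular_rep f \<oplus>\<^bsub>triangular_ring\<^esub> triangular_rep g"
    if "f \<in> carrier (free_algebra V)" "g \<in> carrier (free_algebra V)" for f g
    using that by (simp add: triangular_rep_def triangular_ring_def pairing_add)
  interpret M: ring "triangular_ring :: ('a \<times> 'a \<times> 'a) ring" by (rule ring_triangular_ring)
  interpret F: ring "free_algebra V :: ('a, (nat \<Rightarrow> 'a) list \<Rightarrow> 'a) module" by (rule ring_free_algebra)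
  have carr: "x \<in> carrier triangular_ring" for x :: "'a \<times> 'a \<times> 'a" by (simp add: triangular_ring_def)
  show "triangular_rep (f \<oplus>\<^bsub>free_algebra V\<^esub> g) = triangular_rep f \<oplus>\<^bsub>triangular_ring\<^esub> triangular_rep g"
    using f g by (rule rep_add)
  show "triangular_rep (f \<otimes>\<^bsub>free_algebra V\<^esub> g) = triangular_rep f \<otimes>\<^bsub>triangular_ring\<^esub> triangular_rep g"
    using f g
  \<comment> \<open>The right factor has to vary: for a product f f' the hypothesis for f is applied
    to f' g.\<close>
  proof (induction f arbitrary: g rule: free_algebra_induct)
    case (scalar c)
    show ?case
      unfolding free_algebra_scalar_mult triangular_rep_smult
      by (simp add: triangular_rep_def triangular_ring_def pairing_scalar)
  next
    case (letter v)
    show ?case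
      unfolding triangular_rep_letter
      \<comment> \<open>One instance per entry of the matrix of \<open>v\<close> times that of
        \<open>g\<close>. The diagonal entries have a single term, so their second coefficient is
        0.\<close>
      using pairing_linear[of "v 1" diag1 0 diag1 g] pairing_linear[of "v 1" corner "v 0" diag2 g]
        pairing_linear[of "- v 1" diag2 0 diag2 g] letter.prems
      by (simp add: triangular_rep_def triangular_ring_def pairing_letter_mult)
  next
    case (add f f')
    then show ?case
      by (simp only: F.l_distr F.m_closed rep_add M.l_distr[OF carr carr carr])
  next
    case (mult f f')
    then show ?case
      by (simp only: F.m_assoc F.m_closed M.m_assoc[OF carr carr carr])
  qed
next
  show "triangular_rep \<one>\<^bsub>free_algebra V\<^esub> = \<one>\<^bsub>triangular_ring\<^esub>"
    using pairing_scalar[of diag1 1] pairing_scalar[of corner 1] pairing_scalar[of diag2 1]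
    by (simp add: triangular_rep_def triangular_ring_def free_algebra_def)
qed

section \<open>The counterexample\<close>

text \<open>Coordinate \<open>0\<close> is that of the even idempotent, coordinate \<open>1\<close> that of the odd element; the
  remaining coordinates of the ambient space are not used.\<close>

definition cex_scale :: "'k::field \<Rightarrow> (nat \<Rightarrow> 'k) \<Rightarrow> (nat \<Rightarrow> 'k)" where
  "cex_scale c f = (\<lambda>n. c * f n)"

definition cex_component :: "bit \<Rightarrow> (nat \<Rightarrow> 'k::field) set" where
  "cex_component i = {f. \<forall>n. n \<noteq> (if i = 0 then 0 else 1) \<longrightarrow> f n = 0}"

definition cex_mult :: "(nat \<Rightarrow> 'k::field) \<Rightarrow> (nat \<Rightarrow> 'k) \<Rightarrow> (nat \<Rightarrow> 'k)" where
  "cex_mult f g = (\<lambda>n. if n = 0 then f 0 * g 0 else 0)"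

text \<open>A product is nonzero only if both factors have a nonzero even coordinate. So both sides
  of LA1, LA2 and LA3 vanish, LA0 is associativity in the field, and the sign rule concerns only odd
  pairs, whose product is 0.\<close>

lemma lie_antialgebra_cex:
  "lie_antialgebra (cex_scale :: 'k::field \<Rightarrow> _) cex_component cex_mult"
proof -
  interpret vector_space "cex_scale :: 'k \<Rightarrow> _"
    by unfold_locales (auto simp: cex_scale_def fun_eq_iff algebra_simps)
  show ?thesis
  proof unfold_locales
    fix u v w :: "nat \<Rightarrow> 'k" and c :: 'k and i j :: bit
    show "subspace (cex_component i :: (nat \<Rightarrow> 'k) set)"
      by (auto simp: subspace_def cex_component_def cex_scale_def)
    show "cex_component 0 \<inter> cex_component 1 = {0 :: nat \<Rightarrow> 'k}"
    proof (intro equalityI subsetI)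
      fix f :: "nat \<Rightarrow> 'k" assume "f \<in> cex_component 0 \<inter> cex_component 1"
      then have "f n = 0" for n by (cases "n = 0") (auto simp: cex_component_def)
      then show "f \<in> {0}" by (simp add: fun_eq_iff)
    qed (auto simp: cex_component_def)
    show "cex_mult u v \<in> cex_component (i + j)" if "u \<in> cex_component i" "v \<in> cex_component j"
      using that by (cases i; cases j) (auto simp: cex_component_def cex_mult_def)
    show "cex_mult (u + v) w = cex_mult u w + cex_mult v w"
      "cex_mult u (v + w) = cex_mult u v + cex_mult u w"
      "cex_mult (cex_scale c u) v = cex_scale c (cex_mult u v)"
      "cex_mult u (cex_scale c v) = cex_scale c (cex_mult u v)"
      by (auto simp: cex_mult_def cex_scale_def fun_eq_iff algebra_simps)
    show "cex_mult u v = (if i * j = 1 then - cex_mult v u else cex_mult v u)"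
      if "u \<in> cex_component i" "v \<in> cex_component j"
      using that by (cases i; cases j) (auto simp: cex_component_def cex_mult_def fun_eq_iff)
  qed (auto simp: cex_component_def cex_mult_def cex_scale_def fun_eq_iff)
qed

text \<open>That 2 is nonzero enters on both sides: it makes the factor 1/2 of the enveloping
  relations invertible, and it separates -1 from 1 in the matrices.\<close>

lemma cex_not_isomorphic:
  assumes two: "(2::'k::field) \<noteq> 0"
  shows "\<not> algebra_isomorphic (Gr_enveloping (cex_scale :: 'k \<Rightarrow> _) cex_component cex_mult)
    (G_algebra cex_scale cex_component)"
proof
  interpret cex: lie_antialgebra "cex_scale :: 'k \<Rightarrow> _" cex_component cex_mult
    by (rule lie_antialgebra_cex)
  let ?e = "\<lambda>n. if n = 0 then 1 else 0 :: 'k" and ?a = "\<lambda>n. if n = 1 then 1 else 0 :: 'k"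
  have e: "?e \<in> cex_component 0" and a: "?a \<in> cex_component 1"
    by (auto simp: cex_component_def)
  have U: "s \<otimes>\<^bsub>cex.U\<^esub> t = t \<otimes>\<^bsub>cex.U\<^esub> s" if "s \<in> carrier cex.U" "t \<in> carrier cex.U" for s t
    by (rule cex.enveloping_algebra_commutative[OF two e _ _ _ that])
      (auto simp: cex_component_def cex_mult_def fun_eq_iff)
  have Gr: "f \<otimes>\<^bsub>Gr_enveloping cex_scale cex_component cex_mult\<^esub> g
      = g \<otimes>\<^bsub>Gr_enveloping cex_scale cex_component cex_mult\<^esub> f"
    if "f \<in> carrier (Gr_enveloping (cex_scale :: 'k \<Rightarrow> _) cex_component cex_mult)"
      "g \<in> carrier (Gr_enveloping cex_scale cex_component cex_mult)" for f g
    using that unfolding Gr_enveloping_def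
    by (intro associated_graded_commutative[OF cex.ring_enveloping_algebra]
        cex.enveloping_filtration_carrier U)
  \<comment> \<open>Odd letters go to multiples of diag(1, -1), which commute with each other. The
    opposite diagonal entries make them anticommute with the multiples of the matrix unit E12
    assigned to even letters, and products of the latter vanish.\<close>
  obtain h where h: "ring_hom_ring cex.G triangular_ring h"
    and h_emb: "\<And>v. v \<in> cex.V \<Longrightarrow> h (cex.J +>\<^bsub>cex.T\<^esub> cex.\<iota> v) = triangular_rep (letter v)"
    by (rule cex.G_algebra_lift[OF triangular_rep_hom])
      (auto simp: triangular_rep_letter triangular_rep_smult triangular_ring_def
        cex_component_def cex_scale_def)
  interpret h: ring_hom_ring cex.G triangular_ring h by (rule h)
  let ?E = "cex.J +>\<^bsub>cex.T\<^esub> cex.\<iota> ?e" and ?A = "cex.J +>\<^bsub>cex.T\<^esub> cex.\<iota> ?a"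
  note V = cex.even_supercarrier[OF e] cex.odd_supercarrier[OF a]
  note carr = V[THEN cex.G_algebra_carrier]
  assume "algebra_isomorphic (Gr_enveloping (cex_scale :: 'k \<Rightarrow> _) cex_component cex_mult)
    (G_algebra cex_scale cex_component)"
  then have "?E \<otimes>\<^bsub>cex.G\<^esub> ?A = ?A \<otimes>\<^bsub>cex.G\<^esub> ?E"
    using Gr carr by (rule algebra_isomorphic_commutative)
  then have "h ?E \<otimes>\<^bsub>triangular_ring\<^esub> h ?A = h ?A \<otimes>\<^bsub>triangular_ring\<^esub> h ?E"
    using h.hom_mult[OF carr] h.hom_mult[OF carr(2,1)] by argo
  \<comment> \<open>These are the corner entries of E12 diag(1, -1) and of diag(1, -1) E12.\<close>
  then have "(-1::'k) = 1"
    unfolding h_emb[OF V(1)] h_emb[OF V(2)] triangular_rep_letter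
    by (simp add: triangular_ring_def)
  then show False using two by (metis add.right_inverse one_add_one)
qed

theorem proposition2p3:
  shows "(\<exists>(scale :: real \<Rightarrow> (nat \<Rightarrow> real) \<Rightarrow> (nat \<Rightarrow> real)) A m.
            lie_antialgebra scale A m \<and>
            \<not> algebra_isomorphic (Gr_enveloping scale A m) (G_algebra scale A))
       \<and> (\<exists>(scale :: complex \<Rightarrow> (nat \<Rightarrow> complex) \<Rightarrow> (nat \<Rightarrow> complex)) A m.
            lie_antialgebra scale A m \<and>
            \<not> algebra_isomorphic (Gr_enveloping scale A m) (G_algebra scale A))"
  using lie_antialgebra_cex cex_not_isomorphic[where 'k = real] cex_not_isomorphic[where 'k = complex]
  by (metis zero_neq_numeral)

end
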